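(* Let $M\ge1$, $R_1,\dots,R_M\in\mathbb{R}^3$ and $d>0$ be fixed. For $\underline{Z}=(Z_1,\dots,Z_M)$ with all $Z_\alpha>0$ let $$N_*(\underline{Z})=\sup\{N\in\mathbb{N} : \inf_{\mathcal{A}_N}V_{N,\underline{Z}}\text{ is attained}\},$$ where $V_{N,\underline{Z}}$ and $\mathcal{A}_N$ are defined in the context. Then, along any sequence of $\underline{Z}$ with $Z=\sum_{\alpha=1}^M Z_\alpha\to\infty$ and $Z_\alpha/Z\to z_\alpha$ for $\alpha=1,\dots,M$, $$\frac{N_*(\underline{Z})}{Z}\longrightarrow1.$$
   Context: For $\underline{Z}=(Z_1,\dots,Z_M)$ with $Z_\alpha>0$, define $$V_{N,\underline{Z}}(x_1,\dots,x_N):=\sum_{i=1}^N v(x_i)+\sum_{1\le i<j\le N}\frac{1}{|x_i-x_j|},\qquad v(x)=\sum_{\alpha=1}^M\frac{-Z_\alpha}{|x-R_\alpha|},$$ with the convention $1/0=+\infty$. The admissible set is $$\mathcal{A}_N:=\{(x_1,\dots,x_N)\in\mathbb{R}^{3N} : |x_i-R_\alpha|\ge d\text{ for all } i,\alpha\}.$$ *)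

theory Defs
  imports "HOL-Analysis.Analysis"
begin

text \<open>Nuclei and electrons are indexed by \<open>{1..M}\<close> and \<open>{1..N}\<close>; values of \<open>R\<close> and \<open>Z\<close> outside
  \<open>{1..M}\<close> are never used. Energies live in \<^typ>\<open>ereal\<close>, where \<open>1 / 0 = \<infinity>\<close>.\<close>

definition nuclear_potential ::
  "nat \<Rightarrow> (nat \<Rightarrow> real^3) \<Rightarrow> (nat \<Rightarrow> real) \<Rightarrow> real^3 \<Rightarrow> ereal" where
  "nuclear_potential M R Z x = (\<Sum>\<alpha>=1..M. ereal (- Z \<alpha>) / ereal (norm (x - R \<alpha>)))"

definition total_potential ::
  "nat \<Rightarrow> (nat \<Rightarrow> real^3) \<Rightarrow> (nat \<Rightarrow> real) \<Rightarrow> nat \<Rightarrow> (nat \<Rightarrow> real^3) \<Rightarrow> ereal" where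
  "total_potential M R Z N x =
     (\<Sum>i=1..N. nuclear_potential M R Z (x i)) +
     (\<Sum>i=1..N. \<Sum>j\<in>{i<..N}. 1 / ereal (norm (x i - x j)))"

definition admissible ::
  "nat \<Rightarrow> (nat \<Rightarrow> real^3) \<Rightarrow> real \<Rightarrow> nat \<Rightarrow> (nat \<Rightarrow> real^3) set" where
  "admissible M R d N =
     {x \<in> {1..N} \<rightarrow>\<^sub>E UNIV. \<forall>i\<in>{1..N}. \<forall>\<alpha>\<in>{1..M}. norm (x i - R \<alpha>) \<ge> d}"

definition inf_attained ::
  "nat \<Rightarrow> (nat \<Rightarrow> real^3) \<Rightarrow> real \<Rightarrow> (nat \<Rightarrow> real) \<Rightarrow> nat \<Rightarrow> bool" where
  "inf_attained M R d Z N \<longleftrightarrow>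
     (\<exists>x\<in>admissible M R d N.
        total_potential M R Z N x = (INF y\<in>admissible M R d N. total_potential M R Z N y))"

text \<open>The supremum is taken in \<^typ>\<open>ereal\<close>, so that it is \<open>\<infinity>\<close> if the set is unbounded.
  The degenerate value \<open>N = 0\<close> (a single empty configuration, of energy \<open>0\<close>) belongs to the set.\<close>

definition N_star :: "nat \<Rightarrow> (nat \<Rightarrow> real^3) \<Rightarrow> real \<Rightarrow> (nat \<Rightarrow> real) \<Rightarrow> ereal" where
  "N_star M R d Z = (SUP N\<in>{N. inf_attained M R d Z N}. ereal (real N))"

end

theory Submission
  imports Defs
begin

text \<open>
  Let \<open>\<Phi>\<close> be the attractive potential of the nuclei, of total charge \<open>Z\<close>.

  Lower bound. If \<open>N < Z\<close>, an electron placed far away from a minimizing configuration of \<open>N\<close>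
  electrons has negative energy, so the infimum for \<open>N + 1\<close> electrons is strictly below that for
  \<open>N\<close>. Removing an electron from a nearly optimal configuration of \<open>N + 1\<close> electrons then shows
  that \<open>\<Phi>\<close> is bounded below at each electron; the configuration stays in a bounded set, and compactness
  gives a minimizer. Hence \<open>N\<^sub>* \<ge> Z\<close>.

  Upper bound. In a minimizer no electron gains by moving to infinity, that is,
  \<open>\<Sum>\<^sub>j 1 / |x\<^sub>i - x\<^sub>j| \<le> \<Phi> x\<^sub>i\<close> for every \<open>i\<close>. Surround each electron by a ball of radius
  \<open>h\<close> times its distance to the nuclei. If the potential of the electrons is at most \<open>c \<Phi>\<close> on the
  boundary of the union of the balls, then by the maximum principle it is so outside, and at infinity
  this reads \<open>N \<le> c Z\<close>. Moving from \<open>x\<^sub>i\<close> to the boundary of its ball changes the contribution of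
  an electron \<open>x\<^sub>j\<close> by a factor close to one, or lowers it, unless \<open>|x\<^sub>i - x\<^sub>j|\<close> is comparable to
  the radius. These annuli are disjoint for different scales \<open>h\<close>, so among many scales
  there is one at which they contribute little for all but a small fraction of the electrons;
  these exceptional electrons are discarded.
\<close>

section \<open>The maximum principle for Coulomb potentials\<close>

text \<open>Serves for electrons (unit charges), nuclei and signed combinations of both. A charge
  contributes \<open>0\<close> at its own position since \<open>x / 0 = 0\<close>, so the poles are
  excluded wherever regularity matters.\<close>

definition coulomb :: "'i set \<Rightarrow> ('i \<Rightarrow> real) \<Rightarrow> ('i \<Rightarrow> real^3) \<Rightarrow> real^3 \<Rightarrow> real" where
  "coulomb I c a y = (\<Sum>i\<in>I. c i / norm (y - a i))"

section \<open>Coulomb potentials far from the charges\<close>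

lemma norm_ratio_at_infinity:
  fixes a :: "real^3"
  shows "((\<lambda>y. norm y / norm (y - a)) \<longlongrightarrow> 1) at_infinity"
proof -
  have inf: "filterlim (\<lambda>y::real^3. norm (y - a)) at_top at_infinity"
  proof (rule filterlim_at_top_mono)
    show "filterlim (\<lambda>y::real^3. - norm a + norm y) at_top at_infinity"
      by (rule filterlim_tendsto_add_at_top[OF tendsto_const filterlim_norm_at_top])
    show "\<forall>\<^sub>F y in at_infinity. - norm a + norm y \<le> norm (y - a)"
      by (rule always_eventually) (use norm_triangle_ineq2[of _ a] in \<open>simp add: algebra_simps\<close>)
  qed
  have "((\<lambda>y. norm a / norm (y - a)) \<longlongrightarrow> 0) at_infinity"
    by (rule real_tendsto_divide_at_top[OF tendsto_const inf])
  moreover have "\<forall>\<^sub>F y in at_infinity. norm (norm y / norm (y - a) - 1) \<le> norm a / norm (y - a)"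
  proof -
    have "\<forall>\<^sub>F y in at_infinity. norm (y - a) > 0"
      using inf[unfolded filterlim_at_top_dense] by (rule spec)
    then show ?thesis
    proof (rule eventually_mono)
      fix y assume p: "0 < norm (y - a)"
      have "norm y / norm (y - a) - 1 = (norm y - norm (y - a)) / norm (y - a)"
        using p by (simp add: field_simps)
      moreover have "\<bar>norm y - norm (y - a)\<bar> \<le> norm a"
        using norm_triangle_ineq3[of y "y - a"] by simp
      ultimately show "norm (norm y / norm (y - a) - 1) \<le> norm a / norm (y - a)"
        using p by (simp add: abs_divide divide_right_mono)
    qed
  qed
  ultimately have "((\<lambda>y. norm y / norm (y - a) - 1) \<longlongrightarrow> 0) at_infinity"
    by (rule Lim_null_comparison[rotated])
  then show ?thesis by (simp add: LIM_zero_iff)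
qed

text \<open>Each ratio of \<open>norm y\<close> to \<open>norm (y - a i)\<close> tends to one. The
  limit reads off the total charge, which turns inequalities between potentials into inequalities
  between charges.\<close>

lemma coulomb_at_infinity:
  "((\<lambda>y. norm y * coulomb I c a y) \<longlongrightarrow> sum c I) at_infinity"
proof -
  have "((\<lambda>y. \<Sum>i\<in>I. c i * (norm y / norm (y - a i))) \<longlongrightarrow> (\<Sum>i\<in>I. c i * 1)) at_infinity"
    by (intro tendsto_sum tendsto_mult tendsto_const norm_ratio_at_infinity)
  then show ?thesis
    by (simp add: coulomb_def sum_distrib_left mult_ac)
qed

lemma coulomb_tendsto_0: "(coulomb I c a \<longlongrightarrow> 0) at_infinity"
proof -
  have "((\<lambda>y::real^3. (norm y * coulomb I c a y) / norm y) \<longlongrightarrow> 0) at_infinity"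
    by (rule real_tendsto_divide_at_top[OF coulomb_at_infinity filterlim_norm_at_top])
  moreover have "\<forall>\<^sub>F y::real^3 in at_infinity. norm y > 0"
    by (auto simp: eventually_at_infinity intro!: exI[of _ 1])
  then have "\<forall>\<^sub>F y in at_infinity. (norm y * coulomb I c a y) / norm y = coulomb I c a y"
    by (rule eventually_mono) simp
  ultimately show ?thesis by (rule Lim_transform_eventually)
qed

section \<open>Second derivatives along lines and harmonicity\<close>

lemma second_derivative_test_max:
  fixes g :: "real \<Rightarrow> real"
  assumes g: "\<And>t. \<bar>t\<bar> < e \<Longrightarrow> DERIV g t :> g' t" and g2: "DERIV g' 0 :> D"
    and e: "e > 0" and max: "\<And>t. \<bar>t\<bar> < e \<Longrightarrow> g t \<le> g 0"
  shows "D \<le> 0"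
proof (rule ccontr)
  assume "\<not> D \<le> 0"
  then have D: "D > 0" by simp
  have g0: "g' 0 = 0"
    using DERIV_local_max[OF g[of 0] e] max e by auto
  obtain s where s: "s > 0" "\<And>h. 0 < h \<Longrightarrow> h < s \<Longrightarrow> g' 0 < g' (0 + h)"
    using DERIV_pos_inc_right[OF g2 D] by auto
  define t where "t = min s e / 2"
  have t: "0 < t" "t < s" "t < e" using s(1) e by (auto simp: t_def min_def)
  obtain \<xi> where \<xi>: "0 < \<xi>" "\<xi> < t" "g t - g 0 = (t - 0) * g' \<xi>"
    using MVT2[of 0 t g g'] t g by auto
  have "g' \<xi> > 0" using s(2)[of \<xi>] \<xi> t g0 by auto
  then have "0 < (t - 0) * g' \<xi>" using t by simp
  then have "g t > g 0" using \<xi>(3) by linarith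
  then show False using max[of t] t by auto
qed

lemma power2_norm_line:
  fixes v b :: "'a::real_inner"
  assumes "norm b = 1"
  shows "norm (v + t *\<^sub>R b) ^ 2 = norm v ^ 2 + 2 * t * (v \<bullet> b) + t^2"
proof -
  have "b \<bullet> b = 1" using assms by (simp add: norm_eq_1)
  then show ?thesis
    unfolding power2_norm_eq_inner by (simp add: inner_add_left inner_add_right inner_commute[of b v] power2_eq_square distrib_left)
qed

lemma norm_line:
  fixes v b :: "'a::real_inner"
  assumes "norm b = 1"
  shows "norm (v + t *\<^sub>R b) = sqrt (norm v ^ 2 + 2 * t * (v \<bullet> b) + t^2)"
  by (simp flip: power2_norm_line[OF assms])

lemma norm_line_derivative:
  fixes v b :: "'a::real_inner"
  assumes b: "norm b = 1" and v: "v + t *\<^sub>R b \<noteq> 0"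
  shows "DERIV (\<lambda>t. norm (v + t *\<^sub>R b)) t :> (v \<bullet> b + t) / norm (v + t *\<^sub>R b)"
proof -
  let ?Q = "\<lambda>t. norm v ^ 2 + 2 * t * (v \<bullet> b) + t^2"
  have pos: "?Q t > 0"
    using v by (simp flip: power2_norm_line[OF b])
  have "DERIV ?Q t :> 2 * (v \<bullet> b + t)"
    by (auto intro!: derivative_eq_intros)
  then have "DERIV (\<lambda>t. sqrt (?Q t)) t :> inverse (sqrt (?Q t)) / 2 * (2 * (v \<bullet> b + t))"
    using DERIV_chain2[of sqrt _ ?Q t, OF DERIV_real_sqrt[OF pos]] by blast
  moreover have "(\<lambda>t. sqrt (?Q t)) = (\<lambda>t. norm (v + t *\<^sub>R b))"
    by (rule ext) (rule norm_line[OF b, symmetric])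
  moreover have "inverse (sqrt (?Q t)) / 2 * (2 * (v \<bullet> b + t)) = (v \<bullet> b + t) / norm (v + t *\<^sub>R b)"
  proof -
    have "inverse s / 2 * (2 * w) = w / s" for s w :: real
      by (simp add: inverse_eq_divide)
    then show ?thesis unfolding norm_line[OF b, symmetric] .
  qed
  ultimately show ?thesis by (simp only:)
qed

lemma coulomb_line_derivative:
  assumes b: "norm b = 1" and a: "\<And>i. i \<in> I \<Longrightarrow> y + t *\<^sub>R b \<noteq> a i"
  shows "DERIV (\<lambda>t. coulomb I c a (y + t *\<^sub>R b)) t :>
    (\<Sum>i\<in>I. - c i * ((y - a i) \<bullet> b + t) / norm (y - a i + t *\<^sub>R b) ^ 3)"
  unfolding coulomb_def
proof (rule DERIV_sum)
  fix i assume i: "i \<in> I"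
  have ne: "y - a i + t *\<^sub>R b \<noteq> 0" using a[OF i] by (simp add: algebra_simps)
  have "DERIV (\<lambda>t. c i / norm (y - a i + t *\<^sub>R b)) t :>
     - c i * ((y - a i) \<bullet> b + t) / norm (y - a i + t *\<^sub>R b) ^ 3"
    using DERIV_divide[OF DERIV_const norm_line_derivative[OF b ne], of "c i"] ne
    by (simp add: power3_eq_cube mult.assoc)
  then show "DERIV (\<lambda>t. c i / norm (y + t *\<^sub>R b - a i)) t :>
     - c i * ((y - a i) \<bullet> b + t) / norm (y - a i + t *\<^sub>R b) ^ 3"
    by (simp only: diff_add_eq)
qed

text \<open>Quotient rule applied to the first derivative; the summands are the diagonal entries of
  the Hessian of the Coulomb kernel, whose trace vanishes in three dimensions.\<close>

lemma coulomb_line_second_derivative: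
  assumes b: "norm b = 1" and a: "\<And>i. i \<in> I \<Longrightarrow> y \<noteq> a i"
  shows "DERIV (\<lambda>t. \<Sum>i\<in>I. - c i * ((y - a i) \<bullet> b + t) / norm (y - a i + t *\<^sub>R b) ^ 3) 0 :>
    (\<Sum>i\<in>I. c i * (3 * ((y - a i) \<bullet> b)^2 / norm (y - a i) ^ 5 - 1 / norm (y - a i) ^ 3))"
proof (rule DERIV_sum)
  fix i assume i: "i \<in> I"
  let ?v = "y - a i"
  have v: "norm ?v > 0" using a[OF i] by simp
  have N: "DERIV (\<lambda>t. norm (?v + t *\<^sub>R b)) 0 :> (?v \<bullet> b) / norm ?v"
    using norm_line_derivative[OF b, of ?v 0] v by simp
  have num: "DERIV (\<lambda>t. - c i * (?v \<bullet> b + t)) 0 :> - c i"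
    by (auto intro!: derivative_eq_intros)
  have den: "DERIV (\<lambda>t. norm (?v + t *\<^sub>R b) ^ 3) 0 :> 3 * norm ?v * (?v \<bullet> b)"
    using DERIV_power[OF N, of 3] v by (simp add: power2_eq_square mult_ac)
  have "DERIV (\<lambda>t. - c i * (?v \<bullet> b + t) / norm (?v + t *\<^sub>R b) ^ 3) 0 :>
     (- c i * norm ?v ^ 3 - - c i * (?v \<bullet> b) * (3 * norm ?v * (?v \<bullet> b))) / (norm ?v ^ 3 * norm ?v ^ 3)"
    using DERIV_divide[OF num den] v by simp
  also have "(- c i * norm ?v ^ 3 - - c i * (?v \<bullet> b) * (3 * norm ?v * (?v \<bullet> b))) / (norm ?v ^ 3 * norm ?v ^ 3)
     = c i * (3 * (?v \<bullet> b)^2 / norm ?v ^ 5 - 1 / norm ?v ^ 3)"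
  proof -
    have "(- c * n ^ 3 - - c * p * (3 * n * p)) / (n ^ 3 * n ^ 3) = c * (3 * p\<^sup>2 / n ^ 5 - 1 / n ^ 3)"
      if "n \<noteq> 0" for c n p :: real
    proof -
      have "n ^ 3 * n ^ 3 = n ^ 5 * n" by (simp add: eval_nat_numeral)
      then have "- c * p * (3 * n * p) / (n ^ 3 * n ^ 3) = - c * (3 * p\<^sup>2 / n ^ 5)"
        using that by (simp add: power2_eq_square)
      moreover have "- c * n ^ 3 / (n ^ 3 * n ^ 3) = - c / n ^ 3" using that by (subst times_divide_times_eq[symmetric]) simp
      ultimately show ?thesis by (simp add: diff_divide_distrib right_diff_distrib)
    qed
    from this[of "norm ?v" "c i" "?v \<bullet> b"] show ?thesis using v by simp
  qed
  finally show "DERIV (\<lambda>t. - c i * (?v \<bullet> b + t) / norm (?v + t *\<^sub>R b) ^ 3) 0 :>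
     c i * (3 * (?v \<bullet> b)^2 / norm ?v ^ 5 - 1 / norm ?v ^ 3)" .
qed

text \<open>Off the charges the potential is harmonic, while \<open>\<tau> * norm z ^ 2\<close> has
  Laplacian \<open>6 * \<tau> > 0\<close>. At a maximum every second derivative along a coordinate
  axis would be nonpositive.\<close>

lemma coulomb_no_strict_max:
  assumes I: "finite I" and U: "open U" "y \<in> U" and a: "\<And>i. i \<in> I \<Longrightarrow> a i \<notin> U"
    and \<tau>: "\<tau> > 0"
    and max: "\<And>z. z \<in> U \<Longrightarrow> coulomb I c a z + \<tau> * norm z ^ 2 \<le> coulomb I c a y + \<tau> * norm y ^ 2"
  shows False
proof -
  obtain e where e: "e > 0" "ball y e \<subseteq> U" using U open_contains_ball by blast
  define L where "L b = (\<Sum>i\<in>I. c i * (3 * ((y - a i) \<bullet> b)^2 / norm (y - a i) ^ 5 - 1 / norm (y - a i) ^ 3))" for b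
  have ya: "y \<noteq> a i" if "i \<in> I" for i using a[OF that] U by auto
  have "L b + 2 * \<tau> \<le> 0" if b: "b \<in> Basis" for b :: "real^3"
  proof -
    have nb: "norm b = 1" using b by simp
    have line: "y + t *\<^sub>R b \<in> U" if "\<bar>t\<bar> < e" for t
      using that e(2) nb by (auto simp: subset_eq dist_norm)
    note sq = power2_norm_line[OF nb, of y]
    show ?thesis
    proof (rule second_derivative_test_max[OF _ _ e(1)])
      show "DERIV (\<lambda>t. coulomb I c a (y + t *\<^sub>R b) + \<tau> * norm (y + t *\<^sub>R b) ^ 2) t :>
        (\<Sum>i\<in>I. - c i * ((y - a i) \<bullet> b + t) / norm (y - a i + t *\<^sub>R b) ^ 3) + \<tau> * (2 * (y \<bullet> b) + 2 * t)"
        if "\<bar>t\<bar> < e" for t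
        unfolding sq using line[OF that] a
        by (intro DERIV_add coulomb_line_derivative[OF nb]) (auto intro!: derivative_eq_intros)
      show "DERIV (\<lambda>t. (\<Sum>i\<in>I. - c i * ((y - a i) \<bullet> b + t) / norm (y - a i + t *\<^sub>R b) ^ 3) + \<tau> * (2 * (y \<bullet> b) + 2 * t)) 0 :> L b + 2 * \<tau>"
        unfolding L_def
        by (intro DERIV_add coulomb_line_second_derivative[OF nb] ya) (auto intro!: derivative_eq_intros)
      show "coulomb I c a (y + t *\<^sub>R b) + \<tau> * norm (y + t *\<^sub>R b) ^ 2
         \<le> coulomb I c a (y + 0 *\<^sub>R b) + \<tau> * norm (y + 0 *\<^sub>R b) ^ 2" if "\<bar>t\<bar> < e" for t
        using max[OF line[OF that]] by simp
    qed
  qed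
  then have "(\<Sum>b\<in>Basis. L b + 2 * \<tau>) \<le> 0" by (intro sum_nonpos)
  moreover have "(\<Sum>b\<in>Basis. L b) = 0"
  proof -
    have "(\<Sum>b\<in>Basis. L b) = (\<Sum>i\<in>I. \<Sum>b\<in>Basis. c i * (3 * ((y - a i) \<bullet> b)^2 / norm (y - a i) ^ 5 - 1 / norm (y - a i) ^ 3))"
      unfolding L_def by (rule sum.swap)
    also have "\<dots> = (\<Sum>i\<in>I. 0)"
    proof (rule sum.cong[OF refl])
      fix i assume i: "i \<in> I"
      let ?v = "y - a i"
      have "norm ?v > 0" using ya[OF i] by simp
      have "(\<Sum>b\<in>Basis. (?v \<bullet> b)^2) = norm ?v ^ 2"
        unfolding power2_norm_eq_inner euclidean_inner[of ?v ?v] by (simp add: power2_eq_square)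
      \<comment> \<open>Dimension three enters here: the constant term is summed over three basis
        vectors and cancels the other one.\<close>
      then have "(\<Sum>b\<in>Basis. c i * (3 * (?v \<bullet> b)^2 / norm ?v ^ 5 - 1 / norm ?v ^ 3))
         = c i * (3 * norm ?v ^ 2 / norm ?v ^ 5 - 3 / norm ?v ^ 3)"
        by (simp add: sum_distrib_left[symmetric] sum_subtractf sum_divide_distrib[symmetric])
      also have "3 * norm ?v ^ 2 / norm ?v ^ 5 = 3 / norm ?v ^ 3"
        using \<open>norm ?v > 0\<close> by (intro frac_eq_eq[THEN iffD2]) (simp_all flip: power_add)
      also have "c i * (3 / norm ?v ^ 3 - 3 / norm ?v ^ 3) = 0" by simp
      finally show "(\<Sum>b\<in>Basis. c i * (3 * (?v \<bullet> b)^2 / norm ?v ^ 5 - 1 / norm ?v ^ 3)) = 0" .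
    qed
    finally show ?thesis by simp
  qed
  ultimately show False using \<tau> by (simp add: sum.distrib)
qed

section \<open>The maximum principle and the comparison of charges\<close>

lemma continuous_on_coulomb:
  assumes "\<And>i. i \<in> I \<Longrightarrow> a i \<notin> S"
  shows "continuous_on S (coulomb I c a)"
  unfolding coulomb_def using assms by (intro continuous_intros) auto

text \<open>\<open>C\<close> may be unbounded; decay at infinity replaces boundary values there. A
  small multiple of \<open>norm z ^ 2\<close> makes the potential strictly subharmonic on a
  truncation of \<open>C\<close> by a large ball.\<close>

lemma coulomb_maximum_principle:
  assumes I: "finite I" and C: "closed C" and a: "\<And>i. i \<in> I \<Longrightarrow> a i \<notin> C"
    and bd: "\<And>y. y \<in> frontier C \<Longrightarrow> coulomb I c a y \<le> 0"
    and y: "y \<in> C"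
  shows "coulomb I c a y \<le> 0"
proof (rule ccontr)
  assume "\<not> ?thesis"
  then have pos: "coulomb I c a y > 0" by simp
  define e where "e = coulomb I c a y / 2"
  have e: "e > 0" using pos by (simp add: e_def)
  have "\<forall>\<^sub>F z in at_infinity. coulomb I c a z < e / 2"
    using coulomb_tendsto_0 e by (intro order_tendstoD(2)) auto
  then obtain B where B: "\<And>z. norm z \<ge> B \<Longrightarrow> coulomb I c a z < e / 2"
    by (auto simp: eventually_at_infinity)
  define L where "L = Max {1, B, norm y}"
  have L: "L \<ge> 1" "L \<ge> B" "L \<ge> norm y" by (auto simp: L_def)
  \<comment> \<open>The perturbation is at most \<open>e / 2\<close> in the ball of radius
    \<open>L\<close>. Hence a maximizer of \<open>F\<close> has potential at least
    \<open>3 / 2 * e\<close>, too large for the frontier of \<open>C\<close> and for the sphere of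
    radius \<open>L\<close>.\<close>
  define \<tau> where "\<tau> = e / (2 * L^2)"
  have \<tau>: "\<tau> > 0" using e L by (simp add: \<tau>_def)
  define F where "F z = coulomb I c a z + \<tau> * norm z ^ 2" for z
  have "continuous_on (C \<inter> cball 0 L) F"
    unfolding F_def using a by (intro continuous_intros continuous_on_coulomb) auto
  moreover have "compact (C \<inter> cball 0 L)" using C by (simp add: closed_Int_compact)
  moreover have yC: "y \<in> C \<inter> cball 0 L" using y L by simp
  ultimately obtain w where w: "w \<in> C" "norm w \<le> L" "\<And>z. z \<in> C \<inter> cball 0 L \<Longrightarrow> F z \<le> F w"
    using continuous_attains_sup[of "C \<inter> cball 0 L" F] by (metis IntE IntI empty_iff mem_cball_0)
  have "\<tau> * norm w ^ 2 \<le> \<tau> * L ^ 2" using w(2) \<tau> by (intro mult_left_mono power_mono) auto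
  also have "\<dots> = e / 2" using L by (simp add: \<tau>_def)
  finally have "\<tau> * norm w ^ 2 \<le> e / 2" .
  moreover have "F y \<ge> 2 * e" using \<tau> by (simp add: F_def e_def)
  ultimately have u: "coulomb I c a w \<ge> 3 / 2 * e" using w(3)[OF yC] by (simp add: F_def)
  have "norm w \<noteq> L" using B[of w] u e L by fastforce
  moreover have "w \<notin> frontier C" using bd[of w] u e by fastforce
  ultimately have wU: "w \<in> interior C \<inter> ball 0 L"
    using w C by (auto simp: frontier_def)
  show False
  proof (rule coulomb_no_strict_max[OF I _ wU _ \<tau>])
    show "open (interior C \<inter> ball 0 L)" by (intro open_Int open_interior open_ball)
    show "a i \<notin> interior C \<inter> ball 0 L" if "i \<in> I" for i
      using a[OF that] interior_subset by blast
    show "coulomb I c a z + \<tau> * norm z ^ 2 \<le> coulomb I c a w + \<tau> * norm w ^ 2"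
      if "z \<in> interior C \<inter> ball 0 L" for z
      using w(3)[of z] that interior_subset[of C] by (auto simp: F_def)
  qed
qed

lemma total_charge_nonpos:
  assumes I: "finite I" and C: "closed C" and a: "\<And>i. i \<in> I \<Longrightarrow> a i \<notin> C"
    and bd: "\<And>y. y \<in> frontier C \<Longrightarrow> coulomb I c a y \<le> 0"
    and inf: "\<forall>\<^sub>F y in at_infinity. y \<in> C"
  shows "sum c I \<le> 0"
proof (rule tendsto_upperbound[OF coulomb_at_infinity])
  show "\<forall>\<^sub>F y in at_infinity. norm y * coulomb I c a y \<le> 0"
    using inf by (rule eventually_mono) (simp add: mult_nonneg_nonpos coulomb_maximum_principle[OF I C a bd])
qed (rule trivial_limit_at_infinity)

lemma eventually_norm_diff_gt:
  fixes a :: "real^3"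
  shows "\<forall>\<^sub>F y in at_infinity. b < norm (y - a)"
proof -
  have "b < norm (y - a)" if "norm y \<ge> b + norm a + 1" for y
    using that norm_triangle_ineq2[of y a] by linarith
  then show ?thesis unfolding eventually_at_infinity by blast
qed

text \<open>The maximum principle is applied to electrons minus nuclei outside balls around all of
  them. Only the spheres around electrons need a hypothesis: close to a nucleus the attraction
  dominates by itself.\<close>

lemma charge_comparison:
  fixes J :: "'i set" and A :: "'j set"
  assumes J: "finite J" and A: "finite A" and q: "\<And>\<alpha>. \<alpha> \<in> A \<Longrightarrow> q \<alpha> > 0"
    and h: "\<And>j. j \<in> J \<Longrightarrow> h j > 0"
    and bd: "\<And>y i. i \<in> J \<Longrightarrow> norm (y - x i) = h i \<Longrightarrow> (\<And>j. j \<in> J \<Longrightarrow> h j \<le> norm (y - x j)) \<Longrightarrow>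
       (\<Sum>j\<in>J. 1 / norm (y - x j)) \<le> coulomb A q R y"
  shows "real (card J) \<le> sum q A"
proof -
  \<comment> \<open>\<open>H\<close> bounds the electron potential outside the electron balls; the
    summand \<open>1\<close> keeps it positive if \<open>J\<close> is empty. With radius
    \<open>q \<alpha> / H\<close> the nucleus \<open>\<alpha>\<close> alone contributes
    \<open>H\<close> on its sphere.\<close>
  define H where "H = 1 + (\<Sum>j\<in>J. 1 / h j)"
  have H: "H > 0" unfolding H_def by (intro add_pos_nonneg sum_nonneg) (auto dest: h intro: less_imp_le)
  define \<rho> where "\<rho> \<alpha> = q \<alpha> / H" for \<alpha>
  have \<rho>: "\<rho> \<alpha> > 0" if "\<alpha> \<in> A" for \<alpha> using q[OF that] H by (simp add: \<rho>_def)
  define I where "I = J <+> A"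
  define c :: "'i + 'j \<Rightarrow> real" where "c = case_sum (\<lambda>_. 1) (\<lambda>\<alpha>. - q \<alpha>)"
  define a where "a = case_sum x R"
  have u: "coulomb I c a y = (\<Sum>j\<in>J. 1 / norm (y - x j)) - coulomb A q R y" for y
    using J A by (simp add: coulomb_def I_def sum.Plus c_def a_def sum_negf)
  define C where "C = {y. (\<forall>j\<in>J. h j \<le> norm (y - x j)) \<and> (\<forall>\<alpha>\<in>A. \<rho> \<alpha> \<le> norm (y - R \<alpha>))}"
  define U where "U = {y. (\<forall>j\<in>J. h j < norm (y - x j)) \<and> (\<forall>\<alpha>\<in>A. \<rho> \<alpha> < norm (y - R \<alpha>))}"
  have clC: "closed C" unfolding C_def Ball_def
    by (intro closed_Collect_conj closed_Collect_all closed_Collect_imp open_Collect_const closed_Collect_le continuous_intros)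
  have "U = (\<Inter>j\<in>J. {y. h j < norm (y - x j)}) \<inter> (\<Inter>\<alpha>\<in>A. {y. \<rho> \<alpha> < norm (y - R \<alpha>)})"
    by (auto simp: U_def)
  then have "open U" using J A
    by (auto intro!: open_Int open_INT open_Collect_less continuous_intros)
  then have "U \<subseteq> interior C" by (intro interior_maximal) (auto simp: U_def C_def intro: less_imp_le)
  \<comment> \<open>At a frontier point one of the strict inequalities defining \<open>U\<close>
    fails, so the point lies on one of the spheres.\<close>
  then have fr: "frontier C \<subseteq> C - U" using clC by (auto simp: frontier_def)
  have "sum c I \<le> 0"
  proof (rule total_charge_nonpos[OF _ clC])
    show "finite I" using J A by (simp add: I_def)
    show "a i \<notin> C" if "i \<in> I" for i
      using that h \<rho> by (force simp: I_def a_def C_def not_le)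
    show "\<forall>\<^sub>F y in at_infinity. y \<in> C"
    proof -
      have "\<forall>\<^sub>F y in at_infinity. (\<forall>j\<in>J. h j < norm (y - x j)) \<and> (\<forall>\<alpha>\<in>A. \<rho> \<alpha> < norm (y - R \<alpha>))"
        using J A by (intro eventually_conj eventually_ball_finite ballI eventually_norm_diff_gt)
      then show ?thesis by (rule eventually_mono) (auto simp: C_def intro: less_imp_le)
    qed
    show "coulomb I c a y \<le> 0" if y: "y \<in> frontier C" for y
    proof -
      have yC: "\<And>j. j \<in> J \<Longrightarrow> h j \<le> norm (y - x j)" "\<And>\<alpha>. \<alpha> \<in> A \<Longrightarrow> \<rho> \<alpha> \<le> norm (y - R \<alpha>)" "y \<notin> U"
        using y fr by (auto simp: C_def)
      consider i where "i \<in> J" "norm (y - x i) = h i" | \<alpha> where "\<alpha> \<in> A" "norm (y - R \<alpha>) = \<rho> \<alpha>"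
        using yC by (fastforce simp: U_def)
      then show ?thesis
      proof cases
        case 1
        then show ?thesis using bd yC(1) by (simp add: u)
      next
        case 2
        have "(\<Sum>j\<in>J. 1 / norm (y - x j)) \<le> (\<Sum>j\<in>J. 1 / h j)"
          using yC(1) h by (intro sum_mono divide_left_mono) (auto intro: mult_pos_pos less_le_trans)
        also have "\<dots> \<le> H" by (simp add: H_def)
        also have "H = q \<alpha> / norm (y - R \<alpha>)" using 2 q[of \<alpha>] H by (simp add: \<rho>_def)
        also have "\<dots> \<le> coulomb A q R y"
          unfolding coulomb_def using 2 A q
          by (intro member_le_sum[where f="\<lambda>\<alpha>. q \<alpha> / norm (y - R \<alpha>)"]) (auto intro!: divide_nonneg_nonneg dest!: q)
        finally show ?thesis by (simp add: u)
      qed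
    qed
  qed
  moreover have "sum c I = real (card J) - sum q A"
    using J A by (simp add: I_def sum.Plus c_def sum_negf)
  ultimately show ?thesis by simp
qed

section \<open>Approximate neutrality\<close>

text \<open>Markov's inequality at each scale combined with double counting: if every scale had too
  many large values, the sum over all indices and scales would exceed \<open>card I\<close>.\<close>

lemma exists_scale_few_large:
  fixes f :: "'i \<Rightarrow> nat \<Rightarrow> real"
  assumes I: "finite I" and K: "K > 0" and t: "t > 0"
    and nonneg: "\<And>i k. i \<in> I \<Longrightarrow> f i k \<ge> 0"
    and sum: "\<And>i. i \<in> I \<Longrightarrow> (\<Sum>k<K. f i k) \<le> 1"
  obtains k where "k < K" "real K * t * real (card {i\<in>I. f i k > t}) \<le> real (card I)"
proof (rule ccontr)
  assume no: "\<not> thesis"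
  let ?B = "\<lambda>k. {i\<in>I. f i k > t}"
  have "real (card I) = (\<Sum>k<K. real (card I) / real K)"
    using K by simp
  also have "\<dots> < (\<Sum>k<K. t * real (card (?B k)))"
  proof (rule sum_strict_mono)
    fix k assume "k \<in> {..<K}"
    then show "real (card I) / real K < t * real (card (?B k))"
      using no that[of k] K by (fastforce simp: field_simps not_le)
  qed (use K in auto)
  also have "\<dots> \<le> (\<Sum>k<K. \<Sum>i\<in>I. f i k)"
  proof (rule sum_mono)
    fix k
    have "t * real (card (?B k)) = (\<Sum>i\<in>?B k. t)" by simp
    also have "\<dots> \<le> (\<Sum>i\<in>?B k. f i k)" by (intro sum_mono) auto
    also have "\<dots> \<le> (\<Sum>i\<in>I. f i k)" using I nonneg by (intro sum_mono2) auto
    finally show "t * real (card (?B k)) \<le> (\<Sum>i\<in>I. f i k)" .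
  qed
  also have "\<dots> = (\<Sum>i\<in>I. \<Sum>k<K. f i k)" by (rule sum.swap)
  also have "\<dots> \<le> (\<Sum>i\<in>I. 1)" using sum by (intro sum_mono) auto
  finally show False by simp
qed

text \<open>If \<open>p'\<close> is much closer to \<open>p\<close> than \<open>H\<close>, the shift
  to \<open>y\<close> does not decrease the distance; if \<open>p'\<close> is far away, it costs a
  factor \<open>m / (m - 1)\<close>. In the annulus between, \<open>lb\<close> limits the loss to a
  factor \<open>2 * m\<close>.\<close>

lemma shifted_coulomb_kernel_le:
  fixes y p p' :: "'a::real_normed_vector"
  assumes m: "(m::real) \<ge> 2" and y: "norm (y - p) = H" and H: "H > 0" and pp: "p \<noteq> p'"
    and lb: "norm (p - p') < m * H \<Longrightarrow> H / 2 \<le> norm (y - p')"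
  shows "1 / norm (y - p') \<le> m / (m - 1) * (1 / norm (p - p'))
     + (if H / m \<le> norm (p - p') \<and> norm (p - p') < m * H then 2 * m * (1 / norm (p - p')) else 0)"
proof -
  define r where "r = norm (p - p')"
  define s where "s = norm (y - p')"
  have r: "r > 0" using pp by (simp add: r_def)
  have tri: "r - H \<le> s" "H - r \<le> s"
    using norm_triangle_ineq[of "p - y" "y - p'"] norm_triangle_ineq[of "y - p'" "p' - p"] y
    by (auto simp: r_def s_def norm_minus_commute)
  have inv: "1 / s \<le> c / r" if "r \<le> c * s" "s > 0" for c
    using that r by (simp add: field_simps)
  have mm: "m / (m - 1) \<ge> 1" using m by (simp add: field_simps)
  consider "r < H / m" | "m * H \<le> r" | "H / m \<le> r" "r < m * H" by linarith
  then have "1 / s \<le> m / (m - 1) * (1 / r) + (if H / m \<le> r \<and> r < m * H then 2 * m * (1 / r) else 0)"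
  proof cases
    case 1
    then have "m * r < H" using m by (simp add: field_simps)
    then have "(m - 1) * r \<le> s" using tri by (simp add: algebra_simps)
    moreover have "r \<le> (m - 1) * r" using m r by simp
    ultimately have s: "r \<le> s" by linarith
    then have "1 / s \<le> 1 / r" using r by (simp add: frac_le)
    also have "\<dots> \<le> m / (m - 1) * (1 / r)" using mult_right_mono[OF mm, of "1 / r"] r by simp
    finally show ?thesis using 1 by simp
  next
    case 2
    then have "(m - 1) * r \<le> m * s" using mult_left_mono[OF tri(1), of m] m by (simp add: algebra_simps)
    then have r_le: "r \<le> m / (m - 1) * s" using m by (simp add: field_simps)
    moreover have "s > 0"
    proof -
      have "m / (m - 1) * s > 0" using r_le r by linarith
      then show ?thesis using m by (simp add: zero_less_mult_iff zero_less_divide_iff)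
    qed
    ultimately show ?thesis using inv[of "m / (m - 1)"] 2 by simp
  next
    case 3
    have "H / 2 \<le> s" using lb 3 by (simp add: r_def s_def)
    then have "m * H \<le> m * (2 * s)" using m by (intro mult_left_mono) auto
    then have "r \<le> 2 * m * s" using 3 by (simp add: mult_ac)
    then have "1 / s \<le> 2 * m * (1 / r)" using inv[of "2 * m"] \<open>H / 2 \<le> s\<close> H by simp
    moreover have "0 \<le> m / (m - 1) * (1 / r)" using m r by simp
    ultimately show ?thesis using 3 by simp
  qed
  then show ?thesis by (simp only: r_def s_def)
qed

text \<open>The annuli around the radii \<open>l / m ^ (2 * k + 2)\<close> extend by a factor
  \<open>m\<close> to both sides; consecutive radii differ by \<open>m ^ 2\<close>, so the half-open
  annuli are disjoint and each \<open>j\<close> is counted at most once.\<close>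

lemma sum_geometric_annuli_le:
  fixes g :: "'i \<Rightarrow> real" and r :: "'i \<Rightarrow> real"
  assumes S: "finite S" and m: "(m::real) \<ge> 1" and l: "l > 0" and g: "\<And>j. j \<in> S \<Longrightarrow> g j \<ge> 0"
  shows "(\<Sum>k<K. \<Sum>j\<in>{j\<in>S. l / m ^ (2 * k + 3) \<le> r j \<and> r j < l / m ^ (2 * k + 1)}. g j) \<le> sum g S"
proof -
  let ?T = "\<lambda>k. {j\<in>S. l / m ^ (2 * k + 3) \<le> r j \<and> r j < l / m ^ (2 * k + 1)}"
  have disj: "?T k \<inter> ?T k' = {}" if "k < k'" for k k'
  proof -
    have "m ^ (2 * k + 3) \<le> m ^ (2 * k' + 1)" using m that by (intro power_increasing) auto
    then have "l / m ^ (2 * k' + 1) \<le> l / m ^ (2 * k + 3)"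
      using l m by (intro divide_left_mono) auto
    then have "False" if "j \<in> ?T k" "j \<in> ?T k'" for j using that by simp
    then show ?thesis by blast
  qed
  have "(\<Sum>k<K. sum g (?T k)) = sum g (\<Union>k<K. ?T k)"
  proof (rule sum.UNION_disjoint[symmetric])
    show "\<forall>i\<in>{..<K}. \<forall>j\<in>{..<K}. i \<noteq> j \<longrightarrow> ?T i \<inter> ?T j = {}"
    proof (intro ballI impI)
      fix i j :: nat assume "i \<noteq> j"
      then consider "i < j" | "j < i" by linarith
      then show "?T i \<inter> ?T j = {}"
        using disj[of i j] disj[of j i] by cases (simp_all only: Int_commute)
    qed
  qed (use S in simp_all)
  also have "\<dots> \<le> sum g S" using S g by (intro sum_mono2) auto
  finally show ?thesis .
qed

lemma coulomb_cmult: "coulomb A (\<lambda>\<alpha>. c * Z \<alpha>) R y = c * coulomb A Z R y"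
  by (simp add: coulomb_def sum_distrib_left)

text \<open>The scales are \<open>h = 1 / m ^ (2 * k + 2)\<close> with \<open>k < m\<^sup>3\<close>; the last summand of the constant is the
  potential of an electron on its own sphere, and the factor \<open>1 + 1 / m\<^sup>2\<close> compares the values of
  the nuclear potential at the electron and on this sphere.\<close>

lemma approximate_neutrality:
  fixes x :: "'i \<Rightarrow> real^3" and R :: "'j \<Rightarrow> real^3" and C d :: real and m :: nat
  assumes I: "finite I" and A: "finite A" "A \<noteq> {}" and Z: "\<And>\<alpha>. \<alpha> \<in> A \<Longrightarrow> Z \<alpha> > 0"
    and d: "d > 0" and adm: "\<And>i \<alpha>. i \<in> I \<Longrightarrow> \<alpha> \<in> A \<Longrightarrow> d \<le> norm (x i - R \<alpha>)"
    and inj: "inj_on x I"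
    and C: "C > 0" "\<And>p \<alpha>. (\<And>\<beta>. \<beta> \<in> A \<Longrightarrow> d \<le> norm (p - R \<beta>)) \<Longrightarrow> \<alpha> \<in> A \<Longrightarrow> norm (p - R \<alpha>) \<le> C * infdist p (R ` A)"
    and rep: "\<And>i. i \<in> I \<Longrightarrow> (\<Sum>j\<in>I - {i}. 1 / norm (x i - x j)) \<le> coulomb A Z R (x i)"
    and m: "m \<ge> 2"
  shows "(1 - 1 / real m) * card I \<le>
    (1 + 1 / real m ^ 2) * (real m / (real m - 1) + 2 / real m + C * real m ^ (2 * m ^ 3) / sum Z A) * sum Z A"
proof -
  define \<Phi> where "\<Phi> = coulomb A Z R"
  define l where "l p = infdist p (R ` A)" for p
  define Q where "Q = sum Z A"
  have Q: "Q > 0" using A Z by (simp add: Q_def sum_pos)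
  have mr: "real m \<ge> 2" using m by simp
  have l_le: "l p \<le> norm (p - R \<alpha>)" if "\<alpha> \<in> A" for p \<alpha>
    using infdist_le[of "R \<alpha>" "R ` A" p] that by (simp add: l_def dist_norm)
  have l_pos: "l (x i) > 0" if "i \<in> I" for i
  proof -
    obtain \<alpha> where \<alpha>: "\<alpha> \<in> A" using A by auto
    have "0 < C * l (x i)" using C(2)[OF adm[OF that] \<alpha>] adm[OF that \<alpha>] d by (simp add: l_def)
    then show ?thesis using C(1) by (simp add: zero_less_mult_iff)
  qed
  \<comment> \<open>All nuclei are within \<open>C * l (x i)\<close> of \<open>x i\<close>. This
    later bounds the potential of an electron on its own sphere by a multiple of
    \<open>\<Phi> / Q\<close>.\<close>
  have \<Phi>_lower: "Q / (C * l (x i)) \<le> \<Phi> (x i)" if "i \<in> I" for i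
    unfolding Q_def \<Phi>_def coulomb_def sum_divide_distrib
  proof (intro sum_mono divide_left_mono)
    fix \<alpha> assume \<alpha>: "\<alpha> \<in> A"
    show "norm (x i - R \<alpha>) \<le> C * l (x i)" using C(2)[OF adm[OF that] \<alpha>] by (simp add: l_def)
    show "0 \<le> Z \<alpha>" using Z[OF \<alpha>] by simp
    show "0 < C * l (x i) * norm (x i - R \<alpha>)" using C(1) l_pos[OF that] less_le_trans[OF l_pos[OF that] l_le[OF \<alpha>]] by (intro mult_pos_pos)
  qed
  have \<Phi>_pos: "\<Phi> (x i) > 0" if "i \<in> I" for i
    by (rule less_le_trans[OF divide_pos_pos[OF Q mult_pos_pos[OF C(1) l_pos[OF that]]] \<Phi>_lower[OF that]])
  define T where "T i k = {j\<in>I - {i}. l (x i) / real m ^ (2 * k + 3) \<le> norm (x i - x j) \<and> norm (x i - x j) < l (x i) / real m ^ (2 * k + 1)}" for i k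
  define s where "s i k = (\<Sum>j\<in>T i k. 1 / norm (x i - x j))" for i k
  \<comment> \<open>The value \<open>s i k / \<Phi> (x i)\<close> is the share of the attraction
    matched by the annulus of scale \<open>k\<close>; by \<open>rep\<close> and disjointness the
    shares add up to at most one. With \<open>m ^ 3\<close> scales and threshold
    \<open>1 / m ^ 2\<close>, at most \<open>card I / m\<close> electrons are exceptional.\<close>
  obtain k where k: "k < m ^ 3"
    and few: "real (m ^ 3) * (1 / real m ^ 2) * real (card {i\<in>I. s i k / \<Phi> (x i) > 1 / real m ^ 2}) \<le> real (card I)"
  proof (rule exists_scale_few_large[OF I, of "m ^ 3" "1 / real m ^ 2" "\<lambda>i k. s i k / \<Phi> (x i)"])
    show "s i k / \<Phi> (x i) \<ge> 0" if "i \<in> I" for i k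
      using \<Phi>_pos[OF that] by (simp add: s_def sum_nonneg)
    show "(\<Sum>k<m ^ 3. s i k / \<Phi> (x i)) \<le> 1" if "i \<in> I" for i
    proof -
      have "(\<Sum>k<m ^ 3. s i k) \<le> (\<Sum>j\<in>I - {i}. 1 / norm (x i - x j))"
        unfolding s_def T_def using I mr l_pos[OF that] by (intro sum_geometric_annuli_le) auto
      also have "\<dots> \<le> \<Phi> (x i)" using rep[OF that] by (simp add: \<Phi>_def)
      finally show ?thesis using \<Phi>_pos[OF that] by (simp add: sum_divide_distrib[symmetric])
    qed
  qed (use m in auto)
  define h where "h = 1 / real m ^ (2 * k + 2)"
  have h: "h > 0" using m by (simp add: h_def)
  have hm: "h / m = 1 / real m ^ (2 * k + 3)" "m * h = 1 / real m ^ (2 * k + 1)"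
    using m by (simp_all add: h_def power_add eval_nat_numeral)
  have mh: "m * h \<le> 1 / 2"
  proof -
    have "real m \<le> real m ^ (2 * k + 1)" using mr by (intro self_le_power) auto
    then have "2 \<le> real m ^ (2 * k + 1)" using mr by linarith
    then show ?thesis unfolding hm(2) by (intro frac_le) simp_all
  qed
  have h_le: "h \<le> 1 / real m ^ 2"
    unfolding h_def using mr by (intro divide_left_mono power_increasing) auto
  \<comment> \<open>Since \<open>k < m ^ 3\<close>, the exponent \<open>2 * k + 2\<close> is at most
    \<open>2 * m ^ 3\<close>; the bound no longer depends on \<open>k\<close>.\<close>
  have h_inv: "1 / h \<le> real m ^ (2 * m ^ 3)"
  proof -
    have "real m ^ (2 * k + 2) \<le> real m ^ (2 * m ^ 3)"
      using k mr by (intro power_increasing) auto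
    then show ?thesis by (simp only: h_def inverse_eq_divide[symmetric] inverse_inverse_eq)
  qed
  define c where "c = (1 + 1 / real m ^ 2) * (real m / (real m - 1) + 2 / real m + C * real m ^ (2 * m ^ 3) / Q)"
  \<comment> \<open>The exceptional electrons, which are discarded. The repulsion bound used for the
    remaining ones is still that of the full configuration.\<close>
  define B where "B = {i\<in>I. s i k / \<Phi> (x i) > 1 / real m ^ 2}"
  define J where "J = I - B"
  have J: "finite J" "J \<subseteq> I" using I by (auto simp: J_def)
  have c: "c > 0" using mr C(1) Q unfolding c_def by (intro mult_pos_pos add_pos_pos) auto
  have "real (card J) \<le> (\<Sum>\<alpha>\<in>A. c * Z \<alpha>)"
  proof (rule charge_comparison[where h = "\<lambda>j. h * l (x j)" and R = R and x = x])
    fix y i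
    assume i: "i \<in> J" and yi: "norm (y - x i) = h * l (x i)"
      and yj: "\<And>j. j \<in> J \<Longrightarrow> h * l (x j) \<le> norm (y - x j)"
    have iI: "i \<in> I" using i J by auto
    note lp = l_pos[OF iI] and Pp = \<Phi>_pos[OF iI]
    let ?f = "\<lambda>j. 1 / norm (x i - x j)"
    have "(\<Sum>j\<in>J - {i}. 1 / norm (y - x j)) \<le> (\<Sum>j\<in>J - {i}. real m / (real m - 1) * ?f j + (if j \<in> T i k then 2 * real m * ?f j else 0))"
    proof (rule sum_mono)
      fix j assume j: "j \<in> J - {i}"
      then have jI: "j \<in> I" "x i \<noteq> x j" using J inj iI by (auto simp: inj_on_def)
      have TT: "j \<in> T i k \<longleftrightarrow> h * l (x i) / m \<le> norm (x i - x j) \<and> norm (x i - x j) < m * (h * l (x i))"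
      proof -
        have "h * l (x i) / m = l (x i) / real m ^ (2 * k + 3)" "m * (h * l (x i)) = l (x i) / real m ^ (2 * k + 1)"
          unfolding times_divide_eq_left[symmetric] mult.assoc[symmetric] hm by simp_all
        then show ?thesis using j jI by (simp only: T_def) auto
      qed
      have "1 / norm (y - x j) \<le> real m / (real m - 1) * ?f j
       + (if h * l (x i) / m \<le> norm (x i - x j) \<and> norm (x i - x j) < m * (h * l (x i)) then 2 * real m * ?f j else 0)"
      proof (rule shifted_coulomb_kernel_le[OF mr yi _ jI(2)])
        show "0 < h * l (x i)" using h lp by simp
        \<comment> \<open>The distance to the nuclei is 1-Lipschitz and
          \<open>m * h \<le> 1 / 2\<close>, so the ball around \<open>x j\<close> has at least half
          the radius of the ball around \<open>x i\<close>; \<open>y\<close> lies outside its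
          interior.\<close>
        show "h * l (x i) / 2 \<le> norm (y - x j)" if "norm (x i - x j) < m * (h * l (x i))"
        proof -
          have "norm (x i - x j) \<le> (m * h) * l (x i)" using that by (simp add: mult_ac)
          also have "\<dots> \<le> 1 / 2 * l (x i)" using mh lp by (intro mult_right_mono) auto
          finally have "l (x i) / 2 \<le> l (x j)"
            using infdist_triangle[of "x i" "R ` A" "x j"] by (simp add: l_def dist_norm)
          then have "h * (l (x i) / 2) \<le> h * l (x j)" using h by (intro mult_left_mono) auto
          then show ?thesis using yj[of j] j by simp
        qed
      qed
      then show "1 / norm (y - x j) \<le> real m / (real m - 1) * ?f j + (if j \<in> T i k then 2 * real m * ?f j else 0)"
        by (simp only: TT)
    qed
    also have "\<dots> \<le> (\<Sum>j\<in>I - {i}. real m / (real m - 1) * ?f j + (if j \<in> T i k then 2 * real m * ?f j else 0))"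
      using I J mr by (intro sum_mono2) auto
    also have "\<dots> = real m / (real m - 1) * (\<Sum>j\<in>I - {i}. ?f j) + 2 * real m * s i k"
    proof -
      have "(\<Sum>j\<in>I - {i}. if j \<in> T i k then 2 * real m * ?f j else 0) = (\<Sum>j\<in>T i k. 2 * real m * ?f j)"
        using I by (intro sum.mono_neutral_cong_right) (auto simp: T_def)
      then show ?thesis by (simp add: sum.distrib sum_distrib_left s_def)
    qed
    \<comment> \<open>As \<open>i\<close> is not exceptional, its annulus carries at most
      \<open>\<Phi> (x i) / m ^ 2\<close>, which turns the loss \<open>2 * m\<close> into
      \<open>2 / m\<close>.\<close>
    also have "\<dots> \<le> real m / (real m - 1) * \<Phi> (x i) + 2 * real m * (\<Phi> (x i) / real m ^ 2)"
    proof (intro add_mono mult_left_mono)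
      show "(\<Sum>j\<in>I - {i}. ?f j) \<le> \<Phi> (x i)" using rep[OF iI] by (simp add: \<Phi>_def)
      show "s i k \<le> \<Phi> (x i) / real m ^ 2" using i iI Pp by (simp add: J_def B_def field_simps)
    qed (use mr in simp_all)
    also have "\<dots> = (real m / (real m - 1) + 2 / real m) * \<Phi> (x i)"
      using mr by (simp add: power2_eq_square distrib_right)
    finally have others: "(\<Sum>j\<in>J - {i}. 1 / norm (y - x j)) \<le> (real m / (real m - 1) + 2 / real m) * \<Phi> (x i)" .
    have self: "1 / norm (y - x i) \<le> C * real m ^ (2 * m ^ 3) / Q * \<Phi> (x i)"
    proof -
      have "1 / norm (y - x i) = 1 / h * (1 / l (x i))" using yi by simp
      also have "\<dots> \<le> real m ^ (2 * m ^ 3) * (C * \<Phi> (x i) / Q)"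
      proof (intro mult_mono)
        show "1 / l (x i) \<le> C * \<Phi> (x i) / Q"
          using \<Phi>_lower[OF iI] C(1) Q lp by (simp add: field_simps)
      qed (use h_inv lp in simp_all)
      finally show ?thesis by (simp add: mult_ac)
    qed
    have "(\<Sum>j\<in>J. 1 / norm (y - x j)) = 1 / norm (y - x i) + (\<Sum>j\<in>J - {i}. 1 / norm (y - x j))"
      using J i by (simp add: sum.remove)
    also have "\<dots> \<le> (real m / (real m - 1) + 2 / real m + C * real m ^ (2 * m ^ 3) / Q) * \<Phi> (x i)"
      using add_mono[OF self others] by (simp only: distrib_right add_ac)
    also have "\<dots> \<le> (real m / (real m - 1) + 2 / real m + C * real m ^ (2 * m ^ 3) / Q) * ((1 + 1 / real m ^ 2) * \<Phi> y)"
    proof (rule mult_left_mono)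
      \<comment> \<open>Every nucleus is at distance at least \<open>l (x i)\<close> from
        \<open>x i\<close>, so moving by \<open>h * l (x i)\<close> increases distances to nuclei at
        most by the factor \<open>1 + h\<close>.\<close>
      show "\<Phi> (x i) \<le> (1 + 1 / real m ^ 2) * \<Phi> y"
        unfolding \<Phi>_def coulomb_def sum_distrib_left
      proof (rule sum_mono)
        fix \<alpha> assume \<alpha>: "\<alpha> \<in> A"
        let ?u = "norm (x i - R \<alpha>)" and ?v = "norm (y - R \<alpha>)"
        have hl: "h * l (x i) \<le> h * ?u" using h l_le[OF \<alpha>] by (intro mult_left_mono) auto
        have up: "?u > 0" using adm[OF iI \<alpha>] d by linarith
        have "?v \<le> h * l (x i) + ?u" "?u \<le> h * l (x i) + ?v"
          using norm_triangle_ineq[of "y - x i" "x i - R \<alpha>"] norm_triangle_ineq[of "x i - y" "y - R \<alpha>"] yi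
          by (auto simp: norm_minus_commute)
        then have "?v \<le> (1 + h) * ?u" "(1 - h) * ?u \<le> ?v" using hl by (auto simp: algebra_simps)
        moreover have "h < 1" using mh mult_right_mono[OF mr, of h] h by linarith
        ultimately have vp: "?v > 0" and "?v \<le> (1 + 1 / real m ^ 2) * ?u"
        proof -
          show "?v > 0" using \<open>(1 - h) * ?u \<le> ?v\<close> \<open>h < 1\<close> mult_pos_pos[of "1 - h" ?u] up by linarith
          have "(1 + h) * ?u \<le> (1 + 1 / real m ^ 2) * ?u" using h_le up by (intro mult_right_mono) auto
          then show "?v \<le> (1 + 1 / real m ^ 2) * ?u" using \<open>?v \<le> (1 + h) * ?u\<close> by linarith
        qed
        then have "Z \<alpha> * ?v \<le> Z \<alpha> * ((1 + 1 / real m ^ 2) * ?u)" using Z[OF \<alpha>] by (intro mult_left_mono) auto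
        then show "Z \<alpha> / ?u \<le> (1 + 1 / real m ^ 2) * (Z \<alpha> / ?v)"
          using up vp by (simp add: field_simps)
      qed
      show "0 \<le> real m / (real m - 1) + 2 / real m + C * real m ^ (2 * m ^ 3) / Q"
        using mr C(1) Q by (intro add_nonneg_nonneg) simp_all
    qed
    also have "\<dots> = coulomb A (\<lambda>\<alpha>. c * Z \<alpha>) R y"
      unfolding coulomb_cmult c_def \<Phi>_def by (simp only: mult_ac)
    finally show "(\<Sum>j\<in>J. 1 / norm (y - x j)) \<le> coulomb A (\<lambda>\<alpha>. c * Z \<alpha>) R y" .
  next
    show "h * l (x j) > 0" if "j \<in> J" for j
      using that J(2) h l_pos[of j] by auto
  qed (use J A c Z in simp_all)
  then have cardJ: "real (card J) \<le> c * Q" by (simp add: Q_def sum_distrib_left)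
  have "m * real (card B) \<le> card I"
    using few mr by (simp add: B_def power3_eq_cube power2_eq_square)
  then have "real (card B) \<le> card I / m" using mr by (simp add: field_simps)
  moreover have "real (card I) = card J + card B"
  proof -
    have "card I = card (I - B) + card B"
      using I card_Diff_subset[of B I] card_mono[of I B] by (simp add: B_def)
    then show ?thesis by (simp add: J_def)
  qed
  ultimately have "real (card I) - card I / m \<le> card J" by linarith
  then have "(1 - 1 / real m) * card I \<le> card J" by (simp add: left_diff_distrib)
  from order_trans[OF this cardJ] show ?thesis unfolding c_def Q_def .
qed

section \<open>Minimizing configurations\<close>

text \<open>Tychonoff's theorem for the product topology on functions; it supplies compact sets of
  configurations.\<close>

lemma compact_PiE_UNIV:
  fixes S :: "'i \<Rightarrow> 'a::topological_space set"
  assumes "\<And>i. compact (S i)"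
  shows "compact (PiE UNIV S)"
  using assms compactin_PiE[of "\<lambda>_. euclidean" UNIV S]
  by (simp add: euclidean_product_topology)

text \<open>Summing over both orders of a pair and halving avoids an order on the index set, so that
  electrons can be added, removed and renamed freely.\<close>

definition energy :: "'i set \<Rightarrow> 'j set \<Rightarrow> ('j \<Rightarrow> real) \<Rightarrow> ('j \<Rightarrow> real^3) \<Rightarrow> ('i \<Rightarrow> real^3) \<Rightarrow> real" where
  "energy I A Z R x = (\<Sum>i\<in>I. \<Sum>j\<in>I - {i}. 1 / norm (x i - x j)) / 2 - (\<Sum>i\<in>I. coulomb A Z R (x i))"

lemma energy_insert:
  assumes I: "finite I" and i: "i \<notin> I"
  shows "energy (insert i I) A Z R x =
    energy I A Z R x + (\<Sum>j\<in>I. 1 / norm (x i - x j)) - coulomb A Z R (x i)"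
proof -
  let ?f = "\<lambda>a b. 1 / norm (x a - x b)"
  have "(\<Sum>a\<in>I. \<Sum>b\<in>insert i I - {a}. ?f a b) = (\<Sum>a\<in>I. ?f i a + (\<Sum>b\<in>I - {a}. ?f a b))"
  proof (rule sum.cong[OF refl])
    fix a assume "a \<in> I"
    then have "insert i I - {a} = insert i (I - {a})" using i by auto
    then show "(\<Sum>b\<in>insert i I - {a}. ?f a b) = ?f i a + (\<Sum>b\<in>I - {a}. ?f a b)"
      using I i by (simp add: norm_minus_commute)
  qed
  moreover have "insert i I - {i} = I" using i by auto
  ultimately show ?thesis
    using I i by (simp add: energy_def sum.distrib)
qed

lemma energy_cong:
  assumes "\<And>i. i \<in> I \<Longrightarrow> x i = y i"
  shows "energy I A Z R x = energy I A Z R y"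
  using assms by (simp add: energy_def)

lemma energy_image:
  assumes "inj_on f J"
  shows "energy (f ` J) A Z R x = energy J A Z R (x \<circ> f)"
proof -
  have "(\<Sum>j\<in>f ` J - {f i}. 1 / norm (x (f i) - x j)) = (\<Sum>j\<in>J - {i}. 1 / norm (x (f i) - x (f j)))"
    if "i \<in> J" for i
  proof -
    have "f ` J - {f i} = f ` (J - {i})" using that assms by (auto simp: inj_on_def)
    moreover have "inj_on f (J - {i})" using assms by (rule inj_on_subset) auto
    ultimately show ?thesis by (simp add: sum.reindex)
  qed
  then show ?thesis
    using assms by (simp add: energy_def sum.reindex)
qed

lemma energy_eq_ordered_pairs:
  fixes N :: nat
  shows "energy {1..N} A Z R x =
    (\<Sum>i=1..N. \<Sum>j\<in>{i<..N}. 1 / norm (x i - x j)) - (\<Sum>i=1..N. coulomb A Z R (x i))"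
proof (induction N)
  case 0
  show ?case by (simp add: energy_def)
next
  case (Suc N)
  let ?f = "\<lambda>i j. 1 / norm (x i - x j)"
  have "(\<Sum>i=1..Suc N. \<Sum>j\<in>{i<..Suc N}. ?f i j) = (\<Sum>i=1..N. \<Sum>j\<in>{i<..Suc N}. ?f i j)"
    by simp
  also have "\<dots> = (\<Sum>i=1..N. ?f (Suc N) i + (\<Sum>j\<in>{i<..N}. ?f i j))"
  proof (rule sum.cong[OF refl])
    fix i assume "i \<in> {1..N}"
    then have "{i<..Suc N} = insert (Suc N) {i<..N}" by auto
    then show "(\<Sum>j\<in>{i<..Suc N}. ?f i j) = ?f (Suc N) i + (\<Sum>j\<in>{i<..N}. ?f i j)"
      by (simp add: norm_minus_commute)
  qed
  finally show ?case
    using Suc.IH energy_insert[of "{1..N}" "Suc N" A Z R x]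
    by (simp add: sum.distrib atLeastAtMostSuc_conv)
qed

text \<open>The other repulsion terms are nonnegative, and the pair occurs twice in the halved sum.
  An upper bound on the energy thus keeps electrons apart.\<close>

lemma pair_le_energy:
  assumes I: "finite I" and ij: "i \<in> I" "j \<in> I" "i \<noteq> j"
  shows "1 / norm (x i - x j) \<le> energy I A Z R x + (\<Sum>i\<in>I. coulomb A Z R (x i))"
proof -
  let ?g = "\<lambda>i. \<Sum>j\<in>I - {i}. 1 / norm (x i - x j)"
  have g: "1 / norm (x a - x b) \<le> ?g a" if "a \<in> I" "b \<in> I" "a \<noteq> b" for a b
    using I that by (intro member_le_sum[where f = "\<lambda>b. 1 / norm (x a - x b)"]) auto
  have "?g i + ?g j = sum ?g {i, j}" using ij by simp
  also have "\<dots> \<le> sum ?g I" using I ij by (intro sum_mono2) (auto intro: sum_nonneg)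
  finally show ?thesis
    using g[of i j] g[of j i] ij by (simp add: energy_def norm_minus_commute)
qed

text \<open>The energy is real-valued, with \<open>1 / 0 = 0\<close>, so coinciding electrons have to be excluded explicitly.\<close>

definition config :: "'i set \<Rightarrow> 'j set \<Rightarrow> ('j \<Rightarrow> real^3) \<Rightarrow> real \<Rightarrow> ('i \<Rightarrow> real^3) \<Rightarrow> bool" where
  "config I A R d x \<longleftrightarrow> inj_on x I \<and> (\<forall>i\<in>I. \<forall>\<alpha>\<in>A. d \<le> norm (x i - R \<alpha>))"

definition minimizer :: "'i set \<Rightarrow> 'j set \<Rightarrow> ('j \<Rightarrow> real) \<Rightarrow> ('j \<Rightarrow> real^3) \<Rightarrow> real \<Rightarrow> ('i \<Rightarrow> real^3) \<Rightarrow> bool" where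
  "minimizer I A Z R d x \<longleftrightarrow> config I A R d x \<and> (\<forall>y. config I A R d y \<longrightarrow> energy I A Z R x \<le> energy I A Z R y)"

section \<open>Moving an electron to infinity and adding a distant one\<close>

lemma eventually_config:
  assumes I: "finite I" and A: "finite A" and i: "i \<notin> I" and x: "config I A R d x"
  shows "\<forall>\<^sub>F y in at_infinity. config (insert i I) A R d (x(i := y))"
proof -
  have "\<forall>\<^sub>F y in at_infinity. (\<forall>\<alpha>\<in>A. d < norm (y - R \<alpha>)) \<and> (\<forall>j\<in>I. 0 < norm (y - x j))"
    using I A by (intro eventually_conj eventually_ball_finite ballI eventually_norm_diff_gt)
  then show ?thesis
  proof (rule eventually_mono)
    fix y assume y: "(\<forall>\<alpha>\<in>A. d < norm (y - R \<alpha>)) \<and> (\<forall>j\<in>I. 0 < norm (y - x j))"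
    then have "inj_on (x(i := y)) (insert i I)"
      using x i by (auto simp: config_def inj_on_def)
    then show "config (insert i I) A R d (x(i := y))"
      using x i y by (auto simp: config_def less_imp_le)
  qed
qed

text \<open>Both potentials acting on electron \<open>i\<close> vanish as it is moved to infinity,
  so the minimal energy is at most the energy of the others alone; the difference is repulsion minus
  attraction at \<open>x i\<close>.\<close>

lemma minimizer_repulsion_le_attraction:
  assumes I: "finite I" and A: "finite A" and x: "minimizer I A Z R d x" and i: "i \<in> I"
  shows "(\<Sum>j\<in>I - {i}. 1 / norm (x i - x j)) \<le> coulomb A Z R (x i)"
proof -
  let ?I = "I - {i}"
  have I': "insert i ?I = I" "finite ?I" "i \<notin> ?I" using I i by auto
  have en: "energy I A Z R (x(i := y)) = energy ?I A Z R x + (coulomb ?I (\<lambda>_. 1) x y - coulomb A Z R y)" for y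
  proof -
    have "energy ?I A Z R (x(i := y)) = energy ?I A Z R x" by (rule energy_cong) auto
    moreover have "(\<Sum>j\<in>?I. 1 / norm (y - (x(i := y)) j)) = coulomb ?I (\<lambda>_. 1) x y"
      unfolding coulomb_def by (rule sum.cong) auto
    ultimately show ?thesis using energy_insert[OF I'(2,3), of A Z R "x(i := y)"] I'(1) by simp
  qed
  have "config ?I A R d x" using x by (auto simp: minimizer_def config_def intro: inj_on_subset)
  then have "\<forall>\<^sub>F y in at_infinity. config I A R d (x(i := y))"
    using eventually_config[OF I'(2) A I'(3)] I'(1) by metis
  then have ev: "\<forall>\<^sub>F y in at_infinity. energy I A Z R x - energy ?I A Z R x \<le> coulomb ?I (\<lambda>_. 1) x y - coulomb A Z R y"
  proof (rule eventually_mono)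
    fix y assume "config I A R d (x(i := y))"
    then have "energy I A Z R x \<le> energy I A Z R (x(i := y))" using x by (simp add: minimizer_def)
    then show "energy I A Z R x - energy ?I A Z R x \<le> coulomb ?I (\<lambda>_. 1) x y - coulomb A Z R y"
      by (simp add: en)
  qed
  have "((\<lambda>y. coulomb ?I (\<lambda>_. 1) x y - coulomb A Z R y) \<longlongrightarrow> 0 - 0) at_infinity"
    by (intro tendsto_diff coulomb_tendsto_0)
  then have "energy I A Z R x - energy ?I A Z R x \<le> 0 - 0"
    by (rule tendsto_lowerbound[OF _ ev trivial_limit_at_infinity])
  then show ?thesis using energy_insert[OF I'(2,3), of A Z R x] I'(1) by simp
qed

text \<open>The energy of an additional electron at \<open>y\<close>, times \<open>norm y\<close>,
  tends to \<open>card I - sum Z A < 0\<close>; any sufficiently distant \<open>y\<close> will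
  do.\<close>

lemma exists_lower_energy:
  assumes I: "finite I" and A: "finite A" and i: "i \<notin> I" and x: "config I A R d x"
    and Z: "real (card I) < sum Z A"
  obtains y where "config (insert i I) A R d y" "energy (insert i I) A Z R y < energy I A Z R x"
proof -
  have "((\<lambda>y. norm y * coulomb I (\<lambda>_. 1) x y - norm y * coulomb A Z R y) \<longlongrightarrow> (\<Sum>_\<in>I. 1) - sum Z A) at_infinity"
    by (intro tendsto_diff coulomb_at_infinity)
  then have "\<forall>\<^sub>F y in at_infinity. norm y * coulomb I (\<lambda>_. 1) x y - norm y * coulomb A Z R y < 0"
    by (rule order_tendstoD(2)) (use Z in simp)
  then have "\<forall>\<^sub>F y in at_infinity. config (insert i I) A R d (x(i := y)) \<and>
      norm y * coulomb I (\<lambda>_. 1) x y - norm y * coulomb A Z R y < 0"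
    using eventually_config[OF I A i x] by (simp add: eventually_conj_iff)
  then obtain y where y: "config (insert i I) A R d (x(i := y))"
      "norm y * coulomb I (\<lambda>_. 1) x y - norm y * coulomb A Z R y < 0"
    using eventually_happens'[OF trivial_limit_at_infinity] by blast
  then have "norm y * (coulomb I (\<lambda>_. 1) x y - coulomb A Z R y) < 0"
    by (simp add: right_diff_distrib)
  then have "coulomb I (\<lambda>_. 1) x y - coulomb A Z R y < 0"
    by (simp add: mult_less_0_iff)
  moreover have "energy I A Z R (x(i := y)) = energy I A Z R x"
    using i by (intro energy_cong) auto
  moreover have "(\<Sum>j\<in>I. 1 / norm (y - (x(i := y)) j)) = coulomb I (\<lambda>_. 1) x y"
    unfolding coulomb_def using i by (intro sum.cong) auto
  ultimately have "energy (insert i I) A Z R (x(i := y)) < energy I A Z R x"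
    using energy_insert[OF I i, of A Z R "x(i := y)"] by simp
  then show ?thesis using that y(1) by blast
qed

section \<open>Existence of minimizers\<close>

lemma coulomb_le_far:
  assumes d: "d > 0" and Z: "\<And>\<alpha>. \<alpha> \<in> A \<Longrightarrow> Z \<alpha> \<ge> 0" and p: "\<And>\<alpha>. \<alpha> \<in> A \<Longrightarrow> d \<le> norm (p - R \<alpha>)"
  shows "coulomb A Z R p \<le> sum Z A / d"
  unfolding coulomb_def sum_divide_distrib
proof (rule sum_mono)
  fix \<alpha> assume "\<alpha> \<in> A"
  then show "Z \<alpha> / norm (p - R \<alpha>) \<le> Z \<alpha> / d"
    using Z[of \<alpha>] p[of \<alpha>] d by (intro divide_left_mono mult_pos_pos) auto
qed

text \<open>Minimal energies depend only on the number of electrons, by renaming along a bijection.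
  This is needed when the electron removed is not the one that was inserted.\<close>

lemma minimizer_energy_le:
  assumes x: "minimizer I A Z R d x" and J: "finite I" "finite J" "card I = card J" and y: "config J A R d y"
  shows "energy I A Z R x \<le> energy J A Z R y"
proof -
  obtain f where f: "bij_betw f I J" using J finite_same_card_bij by blast
  then have inj: "inj_on f I" and im: "f ` I = J" by (auto simp: bij_betw_def)
  have "inj_on (y \<circ> f) I" using y inj im by (auto simp: config_def intro: comp_inj_on)
  then have "config I A R d (y \<circ> f)" using y im by (auto simp: config_def)
  then have "energy I A Z R x \<le> energy I A Z R (y \<circ> f)" using x by (simp add: minimizer_def)
  then show ?thesis using energy_image[OF inj, of A Z R y] im by simp
qed

lemma minimizer_exists_insert:
  assumes I: "finite I" and A: "finite A" and i: "i \<notin> I" and d: "d > 0"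
    and Z: "\<And>\<alpha>. \<alpha> \<in> A \<Longrightarrow> Z \<alpha> \<ge> 0"
    and x: "minimizer I A Z R d x" and card: "real (card I) < sum Z A"
  shows "\<exists>y. minimizer (insert i I) A Z R d y"
proof -
  let ?I = "insert i I"
  have cx: "config I A R d x" using x by (simp add: minimizer_def)
  obtain y0 where y0: "config ?I A R d y0" "energy ?I A Z R y0 < energy I A Z R x"
    using exists_lower_energy[OF I A i cx card] by blast
  define e where "e = energy ?I A Z R y0"
  \<comment> \<open>The energy gained by the additional electron. An electron where the attraction
    is below \<open>\<delta>\<close> could be removed from a configuration of energy at most
    \<open>e\<close> to beat the minimum for \<open>I\<close>; so all electrons stay within radius
    \<open>L\<close>.\<close>
  define \<delta> where "\<delta> = energy I A Z R x - e"
  have \<delta>: "\<delta> > 0" using y0 by (simp add: \<delta>_def e_def)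
  have "\<forall>\<^sub>F p in at_infinity. coulomb A Z R p < \<delta>"
    using coulomb_tendsto_0 \<delta> by (rule order_tendstoD(2))
  then obtain L where L: "\<And>p. norm p \<ge> L \<Longrightarrow> coulomb A Z R p < \<delta>"
    by (auto simp: eventually_at_infinity)
  \<comment> \<open>An upper bound on all inverse distances at energy at most \<open>e\<close>;
    \<open>max 1\<close> makes it positive.\<close>
  define b where "b = max 1 (e + (\<Sum>_\<in>?I. sum Z A / d))"
  have b: "b > 0" by (simp add: b_def)
  \<comment> \<open>Coordinates outside the index set are frozen at \<open>0\<close>, which makes
    the product over the whole index type compact without affecting the energy.\<close>
  define S where "S k = (if k \<in> ?I then cball (0::real^3) L else {0})" for k
  define K where "K = PiE UNIV S \<inter> ({z. \<forall>k. k \<in> ?I \<longrightarrow> (\<forall>\<alpha>. \<alpha> \<in> A \<longrightarrow> d \<le> norm (z k - R \<alpha>))}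
     \<inter> {z. \<forall>k. k \<in> ?I \<longrightarrow> (\<forall>l. l \<in> ?I - {k} \<longrightarrow> 1 / b \<le> norm (z k - z l))})"
  have "compact K" unfolding K_def
  proof (rule compact_Int_closed)
    show "compact (PiE UNIV S)" by (rule compact_PiE_UNIV) (auto simp: S_def)
    show "closed ({z. \<forall>k. k \<in> ?I \<longrightarrow> (\<forall>\<alpha>. \<alpha> \<in> A \<longrightarrow> d \<le> norm (z k - R \<alpha>))}
     \<inter> {z. \<forall>k. k \<in> ?I \<longrightarrow> (\<forall>l. l \<in> ?I - {k} \<longrightarrow> 1 / b \<le> norm (z k - z l))})"
      by (intro closed_Int closed_Collect_all closed_Collect_imp open_Collect_const closed_Collect_le
          continuous_intros continuous_on_product_coordinates)
  qed
  have K_config: "config ?I A R d z" if "z \<in> K" for z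
  proof -
    have "z k \<noteq> z l" if "k \<in> ?I" "l \<in> ?I" "k \<noteq> l" for k l
    proof -
      have "1 / b \<le> norm (z k - z l)" using \<open>z \<in> K\<close> that by (auto simp: K_def)
      moreover have "0 < 1 / b" using b by simp
      ultimately show ?thesis by auto
    qed
    then show ?thesis using \<open>z \<in> K\<close> unfolding config_def inj_on_def K_def by blast
  qed
  have into_K: "(\<lambda>k. if k \<in> ?I then z k else 0) \<in> K"
    if z: "config ?I A R d z" and ze: "energy ?I A Z R z \<le> e" for z
  proof -
    have zadm: "d \<le> norm (z k - R \<alpha>)" if "k \<in> ?I" "\<alpha> \<in> A" for k \<alpha>
      using z that by (auto simp: config_def)
    have "z k \<in> cball 0 L" if k: "k \<in> ?I" for k
    proof -
      let ?J = "?I - {k}"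
      have J: "insert k ?J = ?I" "finite ?J" "k \<notin> ?J" using k I by auto
      have "card I = card ?J" using I i k by simp
      moreover have "config ?J A R d z" using z by (auto simp: config_def intro: inj_on_subset)
      ultimately have "energy I A Z R x \<le> energy ?J A Z R z"
        using minimizer_energy_le[OF x I J(2)] by blast
      moreover have "0 \<le> (\<Sum>j\<in>?J. 1 / norm (z k - z j))" by (intro sum_nonneg) auto
      ultimately have "\<delta> \<le> coulomb A Z R (z k)"
        using energy_insert[OF J(2,3), of A Z R z] ze unfolding J(1) \<delta>_def by linarith
      then show ?thesis using L[of "z k"] by fastforce
    qed
    moreover have "1 / b \<le> norm (z k - z l)" if kl: "k \<in> ?I" "l \<in> ?I" "k \<noteq> l" for k l
    proof -
      have "1 / norm (z k - z l) \<le> energy ?I A Z R z + (\<Sum>i\<in>?I. coulomb A Z R (z i))"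
        using I kl by (intro pair_le_energy) auto
      also have "\<dots> \<le> e + (\<Sum>_\<in>?I. sum Z A / d)"
        using ze zadm Z d by (intro add_mono sum_mono coulomb_le_far) auto
      also have "\<dots> \<le> b" by (simp add: b_def)
      finally have "1 / norm (z k - z l) \<le> b" .
      moreover have "norm (z k - z l) > 0" using z kl by (auto simp: config_def inj_on_def)
      ultimately show ?thesis using b by (simp add: field_simps)
    qed
    ultimately show ?thesis using zadm by (auto simp: K_def S_def)
  qed
  have "K \<noteq> {}" using into_K[OF y0(1)] by (auto simp: e_def)
  moreover have "continuous_on K (energy ?I A Z R)"
  proof -
    have c: "continuous_on K (\<lambda>z. z k)" for k
      by (rule continuous_on_subset[OF continuous_on_product_coordinates]) simp
    have "z k - z l \<noteq> 0" if "z \<in> K" "k \<in> ?I" "l \<in> ?I - {k}" for z k l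
      using K_config[OF that(1)] that(2,3) unfolding config_def inj_on_def by auto
    moreover have "z k - R \<alpha> \<noteq> 0" if "z \<in> K" "k \<in> ?I" "\<alpha> \<in> A" for z k \<alpha>
      using K_config[OF that(1)] that(2,3) d unfolding config_def by force
    ultimately show ?thesis
      unfolding energy_def coulomb_def
      by (intro continuous_intros c) auto
  qed
  ultimately obtain w where w: "w \<in> K" "\<And>z. z \<in> K \<Longrightarrow> energy ?I A Z R w \<le> energy ?I A Z R z"
    using continuous_attains_inf[OF \<open>compact K\<close>] by metis
  have le_e: "energy ?I A Z R w \<le> energy ?I A Z R z" if "config ?I A R d z" "energy ?I A Z R z \<le> e" for z
  proof -
    have "energy ?I A Z R z = energy ?I A Z R (\<lambda>k. if k \<in> ?I then z k else 0)"
      by (rule energy_cong) simp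
    then show ?thesis using w(2)[OF into_K[OF that]] by simp
  qed
  \<comment> \<open>Configurations of energy above \<open>e\<close> are no competitors, since
    \<open>w\<close> is at least as good as \<open>y0\<close>.\<close>
  have "energy ?I A Z R w \<le> energy ?I A Z R z" if "config ?I A R d z" for z
    using le_e[OF that] le_e[OF y0(1)] by (fastforce simp: e_def)
  then show ?thesis using K_config[OF w(1)] unfolding minimizer_def by blast
qed

text \<open>Electrons are inserted one by one. Each step needs a charge below \<open>sum Z A\<close>
  only before the insertion, hence the \<open>+ 1\<close>.\<close>

lemma minimizer_exists:
  assumes A: "finite A" and d: "d > 0" and Z: "\<And>\<alpha>. \<alpha> \<in> A \<Longrightarrow> Z \<alpha> \<ge> 0"
    and I: "finite I" and card: "real (card I) < sum Z A + 1"
  shows "\<exists>x. minimizer I A Z R d x"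
  using I card
proof (induction I rule: finite_induct)
  case empty
  show ?case by (auto simp: minimizer_def config_def energy_def)
next
  case (insert i I)
  then obtain x where "minimizer I A Z R d x" by auto
  then show ?case using minimizer_exists_insert[OF insert(1) A insert(2) d Z] insert by auto
qed

section \<open>The maximal number of electrons\<close>

lemma nuclear_potential_eq:
  assumes "d > 0" "\<And>\<alpha>. \<alpha> \<in> {1..M} \<Longrightarrow> d \<le> norm (p - R \<alpha>)"
  shows "nuclear_potential M R Z p = ereal (- coulomb {1..M} Z R p)"
proof -
  have "nuclear_potential M R Z p = (\<Sum>\<alpha>=1..M. ereal (- (Z \<alpha> / norm (p - R \<alpha>))))"
    unfolding nuclear_potential_def
  proof (rule sum.cong[OF refl])
    fix \<alpha> assume "\<alpha> \<in> {1..M}"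
    then have "norm (p - R \<alpha>) \<noteq> 0" using assms(1) assms(2)[of \<alpha>] by linarith
    then show "ereal (- Z \<alpha>) / ereal (norm (p - R \<alpha>)) = ereal (- (Z \<alpha> / norm (p - R \<alpha>)))"
      by simp
  qed
  then show ?thesis by (simp add: coulomb_def sum_negf)
qed

lemma total_potential_eq:
  assumes d: "d > 0" and x: "config {1..N} {1..M} R d x"
  shows "total_potential M R Z N x = ereal (energy {1..N} {1..M} Z R x)"
proof -
  have "(\<Sum>i=1..N. nuclear_potential M R Z (x i)) = ereal (- (\<Sum>i=1..N. coulomb {1..M} Z R (x i)))"
  proof -
    have "(\<Sum>i=1..N. nuclear_potential M R Z (x i)) = (\<Sum>i=1..N. ereal (- coulomb {1..M} Z R (x i)))"
      using x by (intro sum.cong refl nuclear_potential_eq[OF d]) (auto simp: config_def)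
    then show ?thesis by (simp add: sum_negf)
  qed
  moreover have "(\<Sum>i=1..N. \<Sum>j\<in>{i<..N}. 1 / ereal (norm (x i - x j)))
      = (\<Sum>i=1..N. \<Sum>j\<in>{i<..N}. ereal (1 / norm (x i - x j)))"
  proof (intro sum.cong refl)
    fix i j assume "i \<in> {1..N}" "j \<in> {i<..N}"
    moreover have "inj_on x {1..N}" using x by (simp add: config_def)
    ultimately have "x i \<noteq> x j" using inj_onD[of x "{1..N}" i j] by auto
    then show "1 / ereal (norm (x i - x j)) = ereal (1 / norm (x i - x j))"
      unfolding one_ereal_def by simp
  qed
  ultimately show ?thesis
    by (simp add: total_potential_def energy_eq_ordered_pairs del: One_nat_def)
qed

text \<open>A coinciding pair contributes \<open>\<infinity>\<close>, and the nuclear part is finite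
  on admissible configurations, so nothing can cancel it.\<close>

lemma total_potential_PInf:
  assumes d: "d > 0" and x: "x \<in> admissible M R d N" and "\<not> inj_on x {1..N}"
  shows "total_potential M R Z N x = \<infinity>"
proof -
  obtain i j where ij: "i \<in> {1..N}" "j \<in> {i<..N}" "x i = x j"
  proof -
    obtain a b where "a \<in> {1..N}" "b \<in> {1..N}" "x a = x b" "a \<noteq> b"
      using assms(3) by (auto simp: inj_on_def)
    then show ?thesis using that[of a b] that[of b a] by (cases "a < b") auto
  qed
  have "1 / ereal (norm (x i - x j)) = \<infinity>"
    using ij(3) by (simp add: divide_ereal_def)
  then have "(\<Sum>j\<in>{i<..N}. 1 / ereal (norm (x i - x j))) = \<infinity>"
    unfolding sum_Pinfty using ij(2) by blast
  then have "(\<Sum>i=1..N. \<Sum>j\<in>{i<..N}. 1 / ereal (norm (x i - x j))) = \<infinity>"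
    unfolding sum_Pinfty using ij(1) by blast
  moreover have "(\<Sum>i=1..N. nuclear_potential M R Z (x i)) = (\<Sum>i=1..N. ereal (- coulomb {1..M} Z R (x i)))"
    using x by (intro sum.cong refl nuclear_potential_eq[OF d]) (auto simp: admissible_def)
  ultimately show ?thesis by (simp add: total_potential_def)
qed

lemma exists_config:
  assumes "finite I" "finite A"
  shows "\<exists>x. config I A R d x"
  using assms(1)
proof (induction I rule: finite_induct)
  case empty
  show ?case by (simp add: config_def)
next
  case (insert i I)
  then obtain x where "config I A R d x" by auto
  from eventually_happens'[OF trivial_limit_at_infinity eventually_config[OF insert(1) assms(2) insert(2) this]]
  obtain y where "config (insert i I) A R d (x(i := y))" ..
  then show ?case by (intro exI[of _ "x(i := y)"])
qed

lemma admissible_restrict: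
  "config {1..N} {1..M} R d x \<Longrightarrow> restrict x {1..N} \<in> admissible M R d N"
  by (simp add: admissible_def config_def)

lemma total_potential_restrict:
  assumes d: "d > 0" and x: "config {1..N} {1..M} R d x"
  shows "total_potential M R Z N (restrict x {1..N}) = ereal (energy {1..N} {1..M} Z R x)"
proof -
  have "config {1..N} {1..M} R d (restrict x {1..N})"
    using x by (simp add: config_def)
  moreover have "energy {1..N} {1..M} Z R (restrict x {1..N}) = energy {1..N} {1..M} Z R x"
    by (rule energy_cong) simp
  ultimately show ?thesis using total_potential_eq[OF d] by simp
qed

text \<open>Configurations with coinciding electrons have infinite potential and are beaten by any
  injective one, which exists by \<open>exists_config\<close>; on the others potential and energy
  agree.\<close>

lemma inf_attained_iff:
  assumes d: "d > 0"
  shows "inf_attained M R d Z N \<longleftrightarrow> (\<exists>x. minimizer {1..N} {1..M} Z R d x)"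
proof
  assume "inf_attained M R d Z N"
  then obtain x where x: "x \<in> admissible M R d N"
    and min: "total_potential M R Z N x = (INF y\<in>admissible M R d N. total_potential M R Z N y)"
    by (auto simp: inf_attained_def)
  have le: "total_potential M R Z N x \<le> ereal (energy {1..N} {1..M} Z R y)"
    if "config {1..N} {1..M} R d y" for y
    unfolding min total_potential_restrict[OF d that, symmetric]
    by (rule INF_lower) (rule admissible_restrict[OF that])
  obtain y0 where y0: "config {1..N} {1..M} R d y0" using exists_config[of "{1..N}" "{1..M}" R d] by auto
  have "inj_on x {1..N}" using total_potential_PInf[OF d x] le[OF y0] by fastforce
  then have "config {1..N} {1..M} R d x" using x by (simp add: config_def admissible_def)
  then show "\<exists>x. minimizer {1..N} {1..M} Z R d x"
    using le unfolding minimizer_def total_potential_eq[OF d \<open>config {1..N} {1..M} R d x\<close>]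
    by (intro exI[of _ x]) simp
next
  assume "\<exists>x. minimizer {1..N} {1..M} Z R d x"
  then obtain x where x: "minimizer {1..N} {1..M} Z R d x" by blast
  then have cx: "config {1..N} {1..M} R d x" by (simp add: minimizer_def)
  let ?x = "restrict x {1..N}"
  have "total_potential M R Z N ?x = (INF y\<in>admissible M R d N. total_potential M R Z N y)"
  proof (rule antisym)
    show "total_potential M R Z N ?x \<le> (INF y\<in>admissible M R d N. total_potential M R Z N y)"
    proof (rule INF_greatest)
      fix y assume y: "y \<in> admissible M R d N"
      show "total_potential M R Z N ?x \<le> total_potential M R Z N y"
      proof (cases "inj_on y {1..N}")
        case True
        then have "config {1..N} {1..M} R d y" using y by (simp add: config_def admissible_def)
        then show ?thesis
          using x total_potential_eq[OF d] total_potential_restrict[OF d cx] by (simp add: minimizer_def)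
      qed (simp add: total_potential_PInf[OF d y])
    qed
    show "(INF y\<in>admissible M R d N. total_potential M R Z N y) \<le> total_potential M R Z N ?x"
      by (rule INF_lower) (rule admissible_restrict[OF cx])
  qed
  then show "inf_attained M R d Z N"
    unfolding inf_attained_def using admissible_restrict[OF cx] by (rule bexI)
qed

section \<open>Lower and upper bounds in terms of the total charge\<close>

lemma N_star_ge:
  assumes d: "d > 0" and Z: "\<And>\<alpha>. \<alpha> \<in> {1..M} \<Longrightarrow> Z \<alpha> > 0"
  shows "ereal (\<Sum>\<alpha>=1..M. Z \<alpha>) \<le> N_star M R d Z"
proof -
  let ?Q = "\<Sum>\<alpha>=1..M. Z \<alpha>"
  \<comment> \<open>Rounding up is possible because minimizers exist for all
    \<open>N < ?Q + 1\<close>; it gives the bound \<open>?Q\<close> without any error.\<close>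
  define N where "N = nat \<lceil>?Q\<rceil>"
  have "?Q \<ge> 0" using Z by (intro sum_nonneg) (auto intro: less_imp_le)
  then have N: "?Q \<le> N" "N < ?Q + 1" unfolding N_def by linarith+
  then have "inf_attained M R d Z N"
    unfolding inf_attained_iff[OF d] by (intro minimizer_exists d less_imp_le Z) simp_all
  then have "ereal (real N) \<le> N_star M R d Z" unfolding N_star_def by (intro SUP_upper) simp
  then show ?thesis using N(1) order_trans[of "ereal ?Q" "ereal (real N)"] by simp
qed

lemma norm_le_infdist_nuclei:
  fixes R :: "'j \<Rightarrow> real^3"
  assumes A: "finite A" "A \<noteq> {}" and d: "d > 0"
  obtains C where "C > 0" "\<And>p \<alpha>. (\<And>\<beta>. \<beta> \<in> A \<Longrightarrow> d \<le> norm (p - R \<beta>)) \<Longrightarrow> \<alpha> \<in> A \<Longrightarrow> norm (p - R \<alpha>) \<le> C * infdist p (R ` A)"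
proof
  let ?D = "diameter (R ` A)"
  have D: "?D \<ge> 0" using A by (intro diameter_ge_0 finite_imp_bounded) auto
  show "1 + ?D / d > 0" using D d by (simp add: add_pos_nonneg)
  fix p \<alpha> assume p: "\<And>\<beta>. \<beta> \<in> A \<Longrightarrow> d \<le> norm (p - R \<beta>)" and \<alpha>: "\<alpha> \<in> A"
  obtain \<beta> where \<beta>: "\<beta> \<in> A" "infdist p (R ` A) = dist p (R \<beta>)"
    using infdist_attains_inf[of "R ` A" p] A by (auto simp: finite_imp_closed)
  have "dist (R \<beta>) (R \<alpha>) \<le> ?D"
    using A \<alpha> \<beta> by (intro diameter_bounded_bound finite_imp_bounded) auto
  moreover have "?D \<le> ?D / d * infdist p (R ` A)"
  proof -
    have "d \<le> infdist p (R ` A)" using p[OF \<beta>(1)] \<beta>(2) by (simp add: dist_norm)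
    then have "?D / d * d \<le> ?D / d * infdist p (R ` A)" using D d by (intro mult_left_mono) auto
    then show ?thesis using d by simp
  qed
  ultimately show "norm (p - R \<alpha>) \<le> (1 + ?D / d) * infdist p (R ` A)"
    using dist_triangle[of p "R \<alpha>" "R \<beta>"] \<beta>(2) by (simp add: dist_norm distrib_right)
qed

lemma N_star_le:
  fixes C d :: real and m :: nat
  assumes M: "M \<ge> 1" and d: "d > 0" and Z: "\<And>\<alpha>. \<alpha> \<in> {1..M} \<Longrightarrow> Z \<alpha> > 0" and m: "m \<ge> 2"
    and C: "C > 0" "\<And>p \<alpha>. (\<And>\<beta>. \<beta> \<in> {1..M} \<Longrightarrow> d \<le> norm (p - R \<beta>)) \<Longrightarrow> \<alpha> \<in> {1..M} \<Longrightarrow> norm (p - R \<alpha>) \<le> C * infdist p (R ` {1..M})"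
  shows "N_star M R d Z \<le> ereal ((1 + 1 / real m ^ 2) * (real m / (real m - 1) + 2 / real m +
    C * real m ^ (2 * m ^ 3) / (\<Sum>\<alpha>=1..M. Z \<alpha>)) * (\<Sum>\<alpha>=1..M. Z \<alpha>) * (real m / (real m - 1)))"
    (is "_ \<le> ereal (?U * _)")
  unfolding N_star_def
proof (rule SUP_least)
  fix N assume "N \<in> {N. inf_attained M R d Z N}"
  then obtain x where x: "minimizer {1..N} {1..M} Z R d x" by (auto simp: inf_attained_iff[OF d])
  have "(1 - 1 / real m) * real (card {1..N}) \<le> ?U"
  proof (rule approximate_neutrality)
    show "inj_on x {1..N}" using x by (simp add: minimizer_def config_def)
    show "d \<le> norm (x i - R \<alpha>)" if "i \<in> {1..N}" "\<alpha> \<in> {1..M}" for i \<alpha>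
      using x that by (simp add: minimizer_def config_def)
    show "(\<Sum>j\<in>{1..N} - {i}. 1 / norm (x i - x j)) \<le> coulomb {1..M} Z R (x i)" if "i \<in> {1..N}" for i
      by (rule minimizer_repulsion_le_attraction[OF _ _ x that]) simp_all
  qed (use M Z d m C in simp_all)
  \<comment> \<open>The factor \<open>m / (m - 1)\<close> undoes the loss of the discarded
    electrons.\<close>
  moreover have "real (card {1..N}) = (1 - 1 / real m) * real (card {1..N}) * (real m / (real m - 1))"
    using m by (simp add: field_simps)
  ultimately have "real (card {1..N}) \<le> ?U * (real m / (real m - 1))"
    using mult_right_mono[of "(1 - 1 / real m) * real (card {1..N})" ?U "real m / (real m - 1)"] m by simp
  then show "ereal (real N) \<le> ereal (?U * (real m / (real m - 1)))" by simp
qed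

theorem corollary4p1:
  fixes M :: nat and R :: "nat \<Rightarrow> real^3" and d :: real
    and Z :: "nat \<Rightarrow> nat \<Rightarrow> real" and z :: "nat \<Rightarrow> real"
  assumes "M \<ge> 1" and "d > 0"
    and "\<And>n \<alpha>. \<alpha> \<in> {1..M} \<Longrightarrow> Z n \<alpha> > 0"
    and "filterlim (\<lambda>n. \<Sum>\<alpha>=1..M. Z n \<alpha>) at_top sequentially"
    and "\<And>\<alpha>. \<alpha> \<in> {1..M} \<Longrightarrow> (\<lambda>n. Z n \<alpha> / (\<Sum>\<beta>=1..M. Z n \<beta>)) \<longlonglongrightarrow> z \<alpha>"
  shows "(\<lambda>n. N_star M R d (Z n) / ereal (\<Sum>\<alpha>=1..M. Z n \<alpha>)) \<longlonglongrightarrow> 1"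
proof -
  define Q where "Q n = (\<Sum>\<alpha>=1..M. Z n \<alpha>)" for n
  have Q: "Q n > 0" for n unfolding Q_def using assms(1,3) by (intro sum_pos) auto
  obtain C where C: "C > 0"
    "\<And>p \<alpha>. (\<And>\<beta>. \<beta> \<in> {1..M} \<Longrightarrow> d \<le> norm (p - R \<beta>)) \<Longrightarrow> \<alpha> \<in> {1..M} \<Longrightarrow> norm (p - R \<alpha>) \<le> C * infdist p (R ` {1..M})"
    using norm_le_infdist_nuclei[of "{1..M}" d R] assms(1,2) by auto
  \<comment> \<open>The upper bound on \<open>N_star\<close> divided by the total charge, with
    \<open>t\<close> in place of the only term that depends on this charge.\<close>
  define G where "G m t = (1 + 1 / real m ^ 2) * (real m / (real m - 1) + 2 / real m + t) * (real m / (real m - 1))"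
    for m t
  have lower: "1 \<le> N_star M R d (Z n) / ereal (Q n)" for n
    using N_star_ge[OF assms(2,3), where R = R] Q[of n]
    by (simp add: ereal_le_divide_pos Q_def)
  have upper: "N_star M R d (Z n) / ereal (Q n) \<le> ereal (G m (C * real m ^ (2 * m ^ 3) / Q n))"
    if "m \<ge> 2" for m n
  proof -
    note N_star_le[where Z = "Z n", OF assms(1,2) assms(3) that C]
    then have "N_star M R d (Z n) \<le> ereal (Q n) * ereal (G m (C * real m ^ (2 * m ^ 3) / Q n))"
      by (simp add: G_def Q_def mult_ac)
    then show ?thesis using Q[of n] by (subst ereal_divide_le_pos) auto
  qed
  show ?thesis unfolding Q_def[symmetric]
  proof (rule order_tendstoI)
    fix a :: ereal assume "a < 1"
    then show "\<forall>\<^sub>F n in sequentially. a < N_star M R d (Z n) / ereal (Q n)"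
      using lower by (intro always_eventually allI) (rule less_le_trans)
  next
    \<comment> \<open>The order of limits matters: \<open>m\<close> is fixed first with
      \<open>G m 0\<close> below some \<open>r < a\<close>, and then the term of order
      \<open>1 / Q n\<close> vanishes as \<open>n\<close> grows.\<close>
    fix a :: ereal assume "1 < a"
    then obtain r where r: "1 < ereal r" "ereal r < a" using ereal_dense2 by blast
    have "1 < r" using r(1) unfolding one_ereal_def by simp
    have "(\<lambda>m. real m / (real m - 1)) \<longlonglongrightarrow> 1"
    proof (rule Lim_transform_eventually)
      show "(\<lambda>m. 1 / (1 - 1 / real m)) \<longlonglongrightarrow> 1"
        using tendsto_divide[OF tendsto_const tendsto_diff[OF tendsto_const lim_1_over_n], of 1 1] by simp
      show "\<forall>\<^sub>F m in sequentially. 1 / (1 - 1 / real m) = real m / (real m - 1)"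
        using eventually_gt_at_top[of 1] by (rule eventually_mono) (simp add: field_simps)
    qed
    moreover have "(\<lambda>m. 1 + 1 / real m ^ 2) \<longlonglongrightarrow> 1" "(\<lambda>m. 2 / real m) \<longlonglongrightarrow> 0"
      using tendsto_add[OF tendsto_const tendsto_power[OF lim_1_over_n, of 2], of 1]
        tendsto_mult_left[OF lim_1_over_n, of 2] by (simp_all add: power_one_over)
    ultimately have "(\<lambda>m. G m 0) \<longlonglongrightarrow> 1 * (1 + 0 + 0) * 1"
      unfolding G_def by (intro tendsto_mult tendsto_add tendsto_const)
    then have "(\<lambda>m. G m 0) \<longlonglongrightarrow> 1" by simp
    then have "\<forall>\<^sub>F m in sequentially. G m 0 < r \<and> m \<ge> 2"
      using \<open>1 < r\<close> by (intro eventually_conj order_tendstoD(2)[of _ 1] eventually_ge_at_top)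
    then obtain m where m: "G m 0 < r" "m \<ge> 2" by (auto dest: eventually_happens)
    have "(\<lambda>n. G m (C * real m ^ (2 * m ^ 3) / Q n)) \<longlonglongrightarrow> G m 0"
      unfolding G_def Q_def
      by (intro tendsto_intros real_tendsto_divide_at_top[OF tendsto_const assms(4)])
    then have "\<forall>\<^sub>F n in sequentially. G m (C * real m ^ (2 * m ^ 3) / Q n) < r"
      using m(1) by (rule order_tendstoD(2))
    then show "\<forall>\<^sub>F n in sequentially. N_star M R d (Z n) / ereal (Q n) < a"
    proof (rule eventually_mono)
      fix n assume "G m (C * real m ^ (2 * m ^ 3) / Q n) < r"
      then have "ereal (G m (C * real m ^ (2 * m ^ 3) / Q n)) < a" using r(2) less_trans[of "ereal _" "ereal r" a] by simp
      then show "N_star M R d (Z n) / ereal (Q n) < a" using upper[OF m(2), of n] by (rule le_less_trans[rotated])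
    qed
  qed
qed

end
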